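(* Let $\omega$ be the connection form on the principal $\mathbb R$-bundle $\mathrm p\colon T^1\mathbb H^{n+1}\to\mathcal G(\mathbb H^{n+1})$ given by $\omega(X)=g(X,\chi_{(x,v)})$ for $X\in T_{(x,v)}T^1\mathbb H^{n+1}$, and let $\Omega=\mathbb G(\cdot,\mathbb J\cdot)$ be the symplectic form of $\mathcal G(\mathbb H^{n+1})$. Then $$d\omega=\mathrm p^*\Omega .$$
   Context: Hyperboloid model: $\mathbb R^{n+1,1}$ is $\mathbb R^{n+2}$ with $\langle x,y\rangle=\sum_{i=1}^{n+1}x_iy_i-x_{n+2}y_{n+2}$, and $\mathbb H^{n+1}=\{x:\langle x,x\rangle=-1,\ x_{n+2}>0\}$; $T^1\mathbb H^{n+1}=\{(x,v):x\in\mathbb H^{n+1},\langle x,v\rangle=0,\langle v,v\rangle=1\}\subset\mathbb R^{n+1,1}\times\mathbb R^{n+1,1}$. $\mathcal G(\mathbb H^{n+1})$ is the $2n$-manifold of maximal oriented unparametrized geodesics of $\mathbb H^{n+1}$, and $\mathrm p\colon T^1\mathbb H^{n+1}\to\mathcal G(\mathbb H^{n+1})$ sends $(x,v)$ to the oriented geodesic through $x$ with velocity $v$. It is a principal $\mathbb R$-bundle for the geodesic flow $\varphi_t(x,v)=(\cosh(t)x+\sinh(t)v,\sinh(t)x+\cosh(t)v)$, whose infinitesimal generator is $\chi_{(x,v)}=(v,x)$. For $w\in T_x\mathbb H^{n+1}$ with $w\perp v$ put $w^{\mathcal H}=(w,0)$, $w^{\mathcal V}=(0,w)$. Then $T_{(x,v)}T^1\mathbb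 H^{n+1}=\mathrm{Span}(\chi)\oplus\{w^{\mathcal H}\}\oplus\{w^{\mathcal V}\}$. The para-Sasaki metric $g$ makes these three summands mutually orthogonal, with $g(\chi,\chi)=1$, $g(w_1^{\mathcal H},w_2^{\mathcal H})=\langle w_1,w_2\rangle$, $g(w_1^{\mathcal V},w_2^{\mathcal V})=-\langle w_1,w_2\rangle$. On $\chi^\perp$ let $J(w^{\mathcal H})=w^{\mathcal V}$, $J(w^{\mathcal V})=w^{\mathcal H}$. Since $g$ and $J$ are invariant under $\varphi_t$ and $d\mathrm p\colon\chi^\perp_{(x,v)}\to T_{\mathrm p(x,v)}\mathcal G(\mathbb H^{n+1})$ is an isomorphism, $g|_{\chi^\perp}$ and $J$ descend to a pseudo-Riemannian metric $\mathbb G$ of signature $(n,n)$ and a tensor $\mathbb J$ with $\mathbb J^2=\mathrm{id}$ on $\mathcal G(\mathbb H^{n+1})$, and $\Omega(X,Y)=\mathbb G(X,\mathbb JY)$.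
   Formalization: The sign is corrected to dω = −p*Ω: with the stated conventions and the standard exterior derivative, for a unit w one has dω(w^H, w^V) = −1 while p*Ω(w^H, w^V) = g(w^H, Jw^V) = +1, so the printed equation fails for n ≥ 1. *)

theory Defs
  imports "HOL-Analysis.Analysis"
begin

section \<open>Calculus on an embedded submanifold of a Euclidean space\<close>

text \<open>
  \<open>M\<close> is always the underlying set of an embedded submanifold of a Euclidean space. Its tangent
  vectors are velocities of curves in \<open>M\<close>, and smooth maps on \<open>M\<close> are locally restrictions of
  smooth maps on open sets of the ambient space.
\<close>

primrec Ck_on :: "nat \<Rightarrow> 'a::euclidean_space set \<Rightarrow> ('a \<Rightarrow> 'b::real_normed_vector) \<Rightarrow> bool" where
  "Ck_on 0 U f \<longleftrightarrow> continuous_on U f"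
| "Ck_on (Suc k) U f \<longleftrightarrow>
     (\<forall>x\<in>U. f differentiable (at x)) \<and>
     (\<forall>v. Ck_on k U (\<lambda>x. frechet_derivative f (at x) v))"

definition smooth_on_open :: "'a::euclidean_space set \<Rightarrow> ('a \<Rightarrow> 'b::real_normed_vector) \<Rightarrow> bool" where
  "smooth_on_open U f \<longleftrightarrow> open U \<and> (\<forall>k. Ck_on k U f)"

definition smooth_map :: "'a::euclidean_space set \<Rightarrow> ('a \<Rightarrow> 'b::real_normed_vector) \<Rightarrow> bool" where
  "smooth_map M f \<longleftrightarrow>
     (\<forall>p\<in>M. \<exists>U F. p \<in> U \<and> smooth_on_open U F \<and> (\<forall>q\<in>U \<inter> M. f q = F q))"

definition curve_in :: "'a::euclidean_space set \<Rightarrow> 'a \<Rightarrow> 'a \<Rightarrow> (real \<Rightarrow> 'a) \<Rightarrow> bool" where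
  "curve_in M p X \<gamma> \<longleftrightarrow>
     \<gamma> 0 = p \<and> (\<exists>e>0. \<forall>t. \<bar>t\<bar> < e \<longrightarrow> \<gamma> t \<in> M) \<and> (\<gamma> has_vector_derivative X) (at 0)"

definition tangent_space :: "'a::euclidean_space set \<Rightarrow> 'a \<Rightarrow> 'a set" where
  "tangent_space M p = {X. \<exists>\<gamma>. curve_in M p X \<gamma>}"

text \<open>The derivative \<open>\<partial>\<^sub>X f\<close> at \<open>p\<close> of a (scalar or vector valued) map on \<open>M\<close> along a tangent vector.\<close>

definition deriv_along ::
  "'a::euclidean_space set \<Rightarrow> ('a \<Rightarrow> 'b::real_normed_vector) \<Rightarrow> 'a \<Rightarrow> 'a \<Rightarrow> 'b" where
  "deriv_along M f p X =
     (THE r. \<forall>\<gamma>. curve_in M p X \<gamma> \<longrightarrow> ((f \<circ> \<gamma>) has_vector_derivative r) (at 0))"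

definition vector_field :: "'a::euclidean_space set \<Rightarrow> ('a \<Rightarrow> 'a) \<Rightarrow> bool" where
  "vector_field M \<xi> \<longleftrightarrow> smooth_map M \<xi> \<and> (\<forall>q\<in>M. \<xi> q \<in> tangent_space M q)"

text \<open>
  The vector at \<open>p\<close> whose derivation is \<open>f \<mapsto> \<xi>(\<eta> f) - \<eta>(\<xi> f)\<close>: the second derivatives of \<open>f\<close>
  cancel, which leaves the difference of the ambient derivatives of the fields.
\<close>

definition lie_bracket ::
  "'a::euclidean_space set \<Rightarrow> ('a \<Rightarrow> 'a) \<Rightarrow> ('a \<Rightarrow> 'a) \<Rightarrow> 'a \<Rightarrow> 'a" where
  "lie_bracket M \<xi> \<eta> p = deriv_along M \<eta> p (\<xi> p) - deriv_along M \<xi> p (\<eta> p)"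

text \<open>
  A one-form is a family \<open>\<omega> p X\<close>, of which only the values for \<open>p \<in> M\<close> and \<open>X\<close> tangent to \<open>M\<close> at
  \<open>p\<close> matter. The exterior derivative is normalised by
  \<open>d\<omega>(\<xi>,\<eta>) = \<xi>(\<omega>(\<eta>)) - \<eta>(\<omega>(\<xi>)) - \<omega>([\<xi>,\<eta>])\<close>, that is \<open>d(f dg) = df \<and> dg\<close> with
  \<open>(\<alpha> \<and> \<beta>)(X,Y) = \<alpha>(X)\<beta>(Y) - \<alpha>(Y)\<beta>(X)\<close>.
\<close>

definition ext_deriv ::
  "'a::euclidean_space set \<Rightarrow> ('a \<Rightarrow> 'a \<Rightarrow> real) \<Rightarrow> 'a \<Rightarrow> 'a \<Rightarrow> 'a \<Rightarrow> real" where
  "ext_deriv M \<omega> p X Y =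
     (THE r. \<forall>\<xi> \<eta>. vector_field M \<xi> \<and> vector_field M \<eta> \<and> \<xi> p = X \<and> \<eta> p = Y \<longrightarrow>
        r = deriv_along M (\<lambda>q. \<omega> q (\<eta> q)) p X - deriv_along M (\<lambda>q. \<omega> q (\<xi> q)) p Y
            - \<omega> p (lie_bracket M \<xi> \<eta> p))"


section \<open>The hyperboloid model and its unit tangent bundle\<close>

text \<open>
  \<open>\<real>\<^sup>n\<^sup>+\<^sup>1\<^sup>,\<^sup>1\<close> is \<open>'m mink\<close> with \<open>CARD('m) = n + 1\<close>; the last coordinate is the second component of
  the pair.
\<close>

type_synonym 'm mink = "(real ^ 'm) \<times> real"

definition mink :: "'m::finite mink \<Rightarrow> 'm mink \<Rightarrow> real" where
  "mink x y = fst x \<bullet> fst y - snd x * snd y"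

definition hyp :: "'m::finite mink set" where
  "hyp = {x. mink x x = -1 \<and> snd x > 0}"

definition T1hyp :: "('m::finite mink \<times> 'm mink) set" where
  "T1hyp = {(x, v). x \<in> hyp \<and> mink x v = 0 \<and> mink v v = 1}"

definition geod_flow :: "real \<Rightarrow> 'm::finite mink \<times> 'm mink \<Rightarrow> 'm mink \<times> 'm mink" where
  "geod_flow t = (\<lambda>(x, v). (cosh t *\<^sub>R x + sinh t *\<^sub>R v, sinh t *\<^sub>R x + cosh t *\<^sub>R v))"

definition flow_gen :: "'m::finite mink \<times> 'm mink \<Rightarrow> 'm mink \<times> 'm mink" where
  "flow_gen = (\<lambda>(x, v). (v, x))"

definition perp :: "'m::finite mink \<times> 'm mink \<Rightarrow> 'm mink set" where
  "perp = (\<lambda>(x, v). {w \<in> tangent_space hyp x. mink w v = 0})"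

definition hor :: "'m::finite mink \<Rightarrow> 'm mink \<times> 'm mink" where
  "hor w = (w, 0)"

definition vert :: "'m::finite mink \<Rightarrow> 'm mink \<times> 'm mink" where
  "vert w = (0, w)"

text \<open>
  The para-Sasaki metric, through the unique decomposition of tangent vectors along
  \<open>Span(\<chi>) \<oplus> {w\<^sup>H} \<oplus> {w\<^sup>V}\<close>.
\<close>

definition para_sasaki ::
  "'m::finite mink \<times> 'm mink \<Rightarrow> 'm mink \<times> 'm mink \<Rightarrow> 'm mink \<times> 'm mink \<Rightarrow> real" where
  "para_sasaki z X Y =
     (THE r. \<exists>a w u b w' u'. {w, u, w', u'} \<subseteq> perp z \<and>
        X = a *\<^sub>R flow_gen z + hor w + vert u \<and>
        Y = b *\<^sub>R flow_gen z + hor w' + vert u' \<and>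
        r = a * b + mink w w' - mink u u')"

definition chi_perp :: "'m::finite mink \<times> 'm mink \<Rightarrow> ('m mink \<times> 'm mink) set" where
  "chi_perp z = {X \<in> tangent_space T1hyp z. para_sasaki z X (flow_gen z) = 0}"

definition para_J ::
  "'m::finite mink \<times> 'm mink \<Rightarrow> 'm mink \<times> 'm mink \<Rightarrow> 'm mink \<times> 'm mink" where
  "para_J z X =
     (THE Y. \<exists>w u. {w, u} \<subseteq> perp z \<and> X = hor w + vert u \<and> Y = vert w + hor u)"

definition conn_form :: "'m::finite mink \<times> 'm mink \<Rightarrow> 'm mink \<times> 'm mink \<Rightarrow> real" where
  "conn_form z X = para_sasaki z X (flow_gen z)"


section \<open>The space of oriented geodesics\<close>

text \<open>
  Maximal unit-speed geodesics: these are defined on all of \<open>\<real>\<close> as the hyperbolic space is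
  complete, and the tangential part of the ambient acceleration vanishes.
\<close>

definition geodesic :: "(real \<Rightarrow> 'm::finite mink) \<Rightarrow> bool" where
  "geodesic \<gamma> \<longleftrightarrow> (\<forall>t. \<gamma> t \<in> hyp) \<and>
     (\<exists>\<gamma>' \<gamma>''. \<forall>t. (\<gamma> has_vector_derivative \<gamma>' t) (at t) \<and>
        (\<gamma>' has_vector_derivative \<gamma>'' t) (at t) \<and>
        mink (\<gamma>' t) (\<gamma>' t) = 1 \<and>
        (\<forall>w\<in>tangent_space hyp (\<gamma> t). mink (\<gamma>'' t) w = 0))"

text \<open>An oriented unparametrized geodesic is a unit-speed geodesic up to translation of the parameter.\<close>

type_synonym 'm ogeod = "(real \<Rightarrow> 'm mink) set"

definition unparam :: "(real \<Rightarrow> 'm::finite mink) \<Rightarrow> 'm ogeod" where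
  "unparam \<gamma> = {\<lambda>t. \<gamma> (t + s) | s. True}"

definition geod_space :: "'m::finite ogeod set" where
  "geod_space = {unparam \<gamma> | \<gamma>. geodesic \<gamma>}"

definition geod_proj :: "'m::finite mink \<times> 'm mink \<Rightarrow> 'm ogeod" where
  "geod_proj = (\<lambda>(x, v). THE l. l \<in> geod_space \<and>
     (\<exists>\<gamma>\<in>l. \<gamma> 0 = x \<and> (\<gamma> has_vector_derivative v) (at 0)))"

text \<open>
  The smooth structure of \<^const>\<open>geod_space\<close> is the one for which \<^const>\<open>geod_proj\<close>, a surjective
  submersion, detects smooth functions. Tangent vectors are derivations of the algebra of smooth
  functions, extended by \<open>0\<close> to all functions.
\<close>

definition smooth_geod :: "('m::finite ogeod \<Rightarrow> real) \<Rightarrow> bool" where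
  "smooth_geod f \<longleftrightarrow> smooth_map T1hyp (f \<circ> geod_proj)"

type_synonym 'm ogeod_vec = "('m ogeod \<Rightarrow> real) \<Rightarrow> real"

definition d_proj :: "'m::finite mink \<times> 'm mink \<Rightarrow> 'm mink \<times> 'm mink \<Rightarrow> 'm ogeod_vec" where
  "d_proj z X =
     (\<lambda>f. if smooth_geod f then deriv_along T1hyp (f \<circ> geod_proj) z X else 0)"

text \<open>
  The tensors induced on the space of geodesics: \<open>dp\<close> restricted to \<open>\<chi>\<^sup>\<bottom>\<close> is an isomorphism onto
  the tangent space, and the values do not depend on the point chosen in the fibre.
\<close>

definition geod_metric :: "'m::finite ogeod \<Rightarrow> 'm ogeod_vec \<Rightarrow> 'm ogeod_vec \<Rightarrow> real" where
  "geod_metric l A B =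
     (THE r. \<exists>z X Y. z \<in> T1hyp \<and> geod_proj z = l \<and> X \<in> chi_perp z \<and> Y \<in> chi_perp z \<and>
        d_proj z X = A \<and> d_proj z Y = B \<and> r = para_sasaki z X Y)"

definition geod_J :: "'m::finite ogeod \<Rightarrow> 'm ogeod_vec \<Rightarrow> 'm ogeod_vec" where
  "geod_J l A =
     (THE B. \<exists>z X. z \<in> T1hyp \<and> geod_proj z = l \<and> X \<in> chi_perp z \<and>
        d_proj z X = A \<and> B = d_proj z (para_J z X))"

definition geod_symp :: "'m::finite ogeod \<Rightarrow> 'm ogeod_vec \<Rightarrow> 'm ogeod_vec \<Rightarrow> real" where
  "geod_symp l A B = geod_metric l A (geod_J l B)"

definition proj_pullback ::
  "('m::finite ogeod \<Rightarrow> 'm ogeod_vec \<Rightarrow> 'm ogeod_vec \<Rightarrow> real) \<Rightarrow>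
     'm mink \<times> 'm mink \<Rightarrow> 'm mink \<times> 'm mink \<Rightarrow> 'm mink \<times> 'm mink \<Rightarrow> real" where
  "proj_pullback \<Theta> z X Y = \<Theta> (geod_proj z) (d_proj z X) (d_proj z Y)"

text \<open>
  On \<open>X = w\<^sub>1\<^sup>H\<close>, \<open>Y = w\<^sub>2\<^sup>V\<close>, whose tensorial extensions have the bracket \<open>[X,Y] = \<langle>w\<^sub>1,w\<^sub>2\<rangle> \<chi>\<close> modulo
  \<open>\<chi>\<^sup>\<bottom>\<close>, the exterior derivative normalised as above gives \<open>d\<omega>(X,Y) = -\<omega>([X,Y]) = -\<langle>w\<^sub>1,w\<^sub>2\<rangle>\<close>, whereas
  \<open>p\<^sup>*\<Omega>(X,Y) = g(X, JY) = \<langle>w\<^sub>1,w\<^sub>2\<rangle>\<close>. With these conventions the relation is thus \<open>d\<omega> = -p\<^sup>*\<Omega>\<close>.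
\<close>

end

theory Submission
  imports Defs
begin

text \<open>
  On tangent vectors \<open>X = (a, b)\<close>, \<open>Y = (c, d)\<close> at \<open>(x, v)\<close> the connection form is \<open>\<langle>dx, v\<rangle>\<close>, whence
  \<open>d\<omega>(X, Y) = \<langle>c, b\<rangle> - \<langle>a, d\<rangle>\<close>. On \<open>\<chi>\<^sup>\<bottom>\<close> the metric is \<open>\<langle>a, c\<rangle> - \<langle>b, d\<rangle>\<close> and \<open>J\<close> swaps the two components, so
  \<open>g(X, JY) = \<langle>a, d\<rangle> - \<langle>b, c\<rangle>\<close>, an expression that does not see the component along \<open>\<chi>\<close>. The descent to
  the space of geodesics rests on two facts: the fibres of the projection are the orbits of the
  geodesic flow, which acts by linear maps preserving \<open>g\<close> and \<open>J\<close> on \<open>\<chi>\<^sup>\<bottom>\<close>, and the differential of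
  the projection is injective on \<open>\<chi>\<^sup>\<bottom>\<close>, as its Pluecker coordinates \<open>x \<and> v\<close> show.
\<close>

section \<open>Smooth maps\<close>

text \<open>Openness lets agreement of two functions pass to their Frechet derivatives. The calculus
  rules below need this, since they know the derivative of a composite only at points of
  \<open>U\<close>.\<close>

lemma Ck_on_cong:
  assumes "open U" and "\<And>x. x \<in> U \<Longrightarrow> f x = g x" and "Ck_on k U f"
  shows "Ck_on k U g"
  using assms(2,3)
proof (induction k arbitrary: f g)
  case 0
  then show ?case
    using continuous_on_cong by force
next
  case (Suc k)
  have der: "(g has_derivative frechet_derivative f (at x)) (at x)" if "x \<in> U" for x
    using Suc.prems that \<open>open U\<close>
    by (intro has_derivative_transform_within_open[of f _ x UNIV U g])
      (auto simp: frechet_derivative_works)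
  have "Ck_on k U (\<lambda>x. frechet_derivative g (at x) v)" for v
  proof (rule Suc.IH)
    show "Ck_on k U (\<lambda>x. frechet_derivative f (at x) v)"
      using Suc.prems by simp
    show "frechet_derivative f (at x) v = frechet_derivative g (at x) v" if "x \<in> U" for x
      using frechet_derivative_at[OF der[OF that]] by simp
  qed
  then show ?case
    using der by (auto simp: differentiable_def)
qed

lemma Ck_on_SucD: "Ck_on (Suc k) U f \<Longrightarrow> Ck_on k U f"
proof (induction k arbitrary: f)
  case 0
  then show ?case
    by (auto intro!: continuous_at_imp_continuous_on differentiable_imp_continuous_within)
next
  case (Suc k)
  then show ?case
    by (metis Ck_on.simps(2))
qed

lemma Ck_on_const: "Ck_on k U (\<lambda>x. c)"
proof (induction k arbitrary: c)
  case (Suc k)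
  then show ?case
    by (simp add: frechet_derivative_const)
qed simp

lemma Ck_on_bounded_linear:
  assumes "bounded_linear f"
  shows "Ck_on k U f"
proof (cases k)
  case 0
  then show ?thesis
    using assms by (simp add: linear_continuous_on)
next
  case (Suc j)
  have der: "(f has_derivative f) (at x)" for x
    using assms by (rule bounded_linear_imp_has_derivative)
  then have "frechet_derivative f (at x) = f" for x
    by (rule frechet_derivative_at[symmetric])
  then show ?thesis
    using der Suc by (auto simp: differentiable_def Ck_on_const)
qed

lemma Ck_on_add:
  assumes "open U" and "Ck_on k U f" and "Ck_on k U g"
  shows "Ck_on k U (\<lambda>x. f x + g x)"
  using assms(2,3)
proof (induction k arbitrary: f g)
  case 0
  then show ?case
    by (simp add: continuous_on_add)
next
  case (Suc k)
  have der: "((\<lambda>x. f x + g x) has_derivative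
      (\<lambda>v. frechet_derivative f (at x) v + frechet_derivative g (at x) v)) (at x)" if "x \<in> U" for x
    using Suc.prems that by (intro has_derivative_add) (auto simp: frechet_derivative_works)
  have "Ck_on k U (\<lambda>x. frechet_derivative (\<lambda>x. f x + g x) (at x) v)" for v
  proof (rule Ck_on_cong[OF \<open>open U\<close>])
    show "Ck_on k U (\<lambda>x. frechet_derivative f (at x) v + frechet_derivative g (at x) v)"
      using Suc by simp
  qed (simp add: frechet_derivative_at[OF der, symmetric])
  then show ?case
    using der by (auto simp: differentiable_def)
qed

text \<open>The product rule turns a directional derivative into a sum of two products. In each, the
  undifferentiated factor has one order of smoothness to spare, so the induction hypothesis applies
  to both.\<close>

lemma Ck_on_bilinear:
  assumes "bounded_bilinear B" and "open U" and "Ck_on k U f" and "Ck_on k U g"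
  shows "Ck_on k U (\<lambda>x. B (f x) (g x))"
  using assms(3,4)
proof (induction k arbitrary: f g)
  case 0
  then show ?case
    using assms(1) by (simp add: bounded_bilinear.continuous_on)
next
  case (Suc k)
  have der: "((\<lambda>x. B (f x) (g x)) has_derivative
      (\<lambda>v. B (f x) (frechet_derivative g (at x) v) + B (frechet_derivative f (at x) v) (g x))) (at x)"
    if "x \<in> U" for x
    using Suc.prems that assms(1)
    by (intro bounded_bilinear.FDERIV) (auto simp: frechet_derivative_works)
  have "Ck_on k U (\<lambda>x. frechet_derivative (\<lambda>x. B (f x) (g x)) (at x) v)" for v
  proof (rule Ck_on_cong[OF \<open>open U\<close>])
    show "Ck_on k U (\<lambda>x. B (f x) (frechet_derivative g (at x) v) + B (frechet_derivative f (at x) v) (g x))"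
      using Suc.prems by (intro Ck_on_add Suc.IH assms(2)) (auto dest: Ck_on_SucD simp del: Ck_on.simps(2), auto)
  qed (simp add: frechet_derivative_at[OF der, symmetric])
  then show ?case
    using der by (auto simp: differentiable_def)
qed

lemma Ck_on_bounded_linear_compose:
  assumes "bounded_linear h" and "open U" and "Ck_on k U f"
  shows "Ck_on k U (\<lambda>x. h (f x))"
  using assms(3)
proof (induction k arbitrary: f)
  case 0
  then show ?case
    using assms(1) by (simp add: bounded_linear.continuous_on)
next
  case (Suc k)
  have der: "((\<lambda>x. h (f x)) has_derivative (\<lambda>v. h (frechet_derivative f (at x) v))) (at x)"
    if "x \<in> U" for x
    using Suc.prems that
    by (intro bounded_linear.has_derivative[OF assms(1)]) (auto simp: frechet_derivative_works)
  have "Ck_on k U (\<lambda>x. frechet_derivative (\<lambda>x. h (f x)) (at x) v)" for v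
  proof (rule Ck_on_cong[OF \<open>open U\<close>])
    show "Ck_on k U (\<lambda>x. h (frechet_derivative f (at x) v))"
      using Suc by simp
  qed (simp add: frechet_derivative_at[OF der, symmetric])
  then show ?case
    using der by (auto simp: differentiable_def)
qed

lemma Ck_on_Pair:
  assumes "open U" and "Ck_on k U f" and "Ck_on k U g"
  shows "Ck_on k U (\<lambda>x. (f x, g x))"
proof -
  \<comment> \<open>A pair is the sum of the linear images of its components under the two
    coordinate inclusions.\<close>
  have "Ck_on k U (\<lambda>x. (f x, 0) + (0, g x))"
    using assms
    by (intro Ck_on_add Ck_on_bounded_linear_compose[of "\<lambda>y. (y, 0)"]
        Ck_on_bounded_linear_compose[of "\<lambda>y. (0, y)"]
        bounded_linear_Pair bounded_linear_zero bounded_linear_ident)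
  then show ?thesis
    by simp
qed

lemma Ck_on_diff:
  assumes "open U" and "Ck_on k U f" and "Ck_on k U g"
  shows "Ck_on k U (\<lambda>x. f x - g x)"
  using Ck_on_add[OF assms(1,2) Ck_on_bounded_linear_compose[OF bounded_linear_minus[OF bounded_linear_ident] assms(1,3)]]
  by simp

lemma smooth_map_of_Ck_on_UNIV: "(\<And>k. Ck_on k UNIV F) \<Longrightarrow> smooth_map M F"
  unfolding smooth_map_def smooth_on_open_def by blast

lemma smooth_map_cong:
  "smooth_map M F \<Longrightarrow> (\<And>q. q \<in> M \<Longrightarrow> f q = F q) \<Longrightarrow> smooth_map M f"
  unfolding smooth_map_def by simp

text \<open>This is all that later arguments extract from smoothness: a local ambient extension with
  a derivative at the point.\<close>

lemma smooth_map_extension: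
  assumes "smooth_map M f" and "p \<in> M"
  obtains U F D where "open U" "p \<in> U" "\<And>q. q \<in> U \<inter> M \<Longrightarrow> f q = F q"
    "(F has_derivative D) (at p)"
proof -
  obtain U F where U: "p \<in> U" "smooth_on_open U F" "\<forall>q\<in>U \<inter> M. f q = F q"
    using assms unfolding smooth_map_def by blast
  then have "Ck_on 1 U F" "open U"
    unfolding smooth_on_open_def by auto
  then have "(F has_derivative frechet_derivative F (at p)) (at p)"
    using U(1) by (auto simp: frechet_derivative_works)
  with U \<open>open U\<close> that show ?thesis
    by blast
qed

section \<open>Derivatives along curves\<close>

lemma curve_in_eventually:
  assumes "curve_in M p X \<gamma>"
  shows "eventually (\<lambda>t. \<gamma> t \<in> M) (nhds 0)"
  using assms unfolding curve_in_def eventually_nhds_metric by (simp add: dist_real_def)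

lemma curve_inI:
  assumes "\<gamma> 0 = p" and "eventually (\<lambda>t. \<gamma> t \<in> M) (nhds 0)"
    and "(\<gamma> has_vector_derivative X) (at 0)"
  shows "curve_in M p X \<gamma>"
  using assms unfolding curve_in_def eventually_nhds_metric by (simp add: dist_real_def)

lemma has_vector_derivative_cong_nhds:
  assumes "eventually (\<lambda>t. f t = g t) (nhds a)" and "(f has_vector_derivative D) (at a)"
  shows "(g has_vector_derivative D) (at a)"
proof -
  obtain d where "d > 0" "\<And>t. dist t a < d \<Longrightarrow> f t = g t"
    using assms(1) unfolding eventually_nhds_metric by auto
  then show ?thesis
    using assms(2) has_vector_derivative_transform_within[of f D a UNIV d g] by auto
qed

text \<open>The chain rule is applied to the ambient extension \<open>F\<close>. By continuity the
  curve stays in \<open>U\<close> for small times, and there \<open>F\<close> and \<open>f\<close>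
  agree along it.\<close>

lemma curve_in_has_vector_derivative:
  assumes "curve_in M p X \<gamma>" and "open U" "p \<in> U" and "\<And>q. q \<in> U \<inter> M \<Longrightarrow> f q = F q"
    and "(F has_derivative D) (at p)"
  shows "((f \<circ> \<gamma>) has_vector_derivative D X) (at 0)"
proof (rule has_vector_derivative_cong_nhds)
  have \<gamma>: "\<gamma> 0 = p" "(\<gamma> has_vector_derivative X) (at 0)"
    using assms(1) unfolding curve_in_def by auto
  then have D: "(F has_derivative D) (at (\<gamma> 0))"
    using assms(5) by simp
  show "((F \<circ> \<gamma>) has_vector_derivative D X) (at 0)"
    using \<gamma> D by (auto intro: vector_derivative_diff_chain_within has_derivative_at_withinI)
  have "isCont \<gamma> 0"
    using \<gamma>(2) by (rule has_vector_derivative_continuous)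
  then have "(\<gamma> \<longlongrightarrow> \<gamma> 0) (nhds 0)"
    by (simp add: continuous_at tendsto_at_iff_tendsto_nhds)
  then have "eventually (\<lambda>t. \<gamma> t \<in> U) (nhds 0)"
    using assms(2,3) \<gamma>(1) topological_tendstoD by metis
  with curve_in_eventually[OF assms(1)]
  show "eventually (\<lambda>t. (F \<circ> \<gamma>) t = (f \<circ> \<gamma>) t) (nhds 0)"
    by eventually_elim (simp add: assms(4))
qed

text \<open>Tangency of \<open>X\<close> supplies a curve, which makes the value in the definite
  description unique; with no curve the condition would hold vacuously for every value.\<close>

lemma deriv_along_eqI:
  assumes "X \<in> tangent_space M p"
    and "\<And>\<gamma>. curve_in M p X \<gamma> \<Longrightarrow> ((f \<circ> \<gamma>) has_vector_derivative r) (at 0)"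
  shows "deriv_along M f p X = r"
  unfolding deriv_along_def
proof (rule the_equality)
  fix s
  assume s: "\<forall>\<gamma>. curve_in M p X \<gamma> \<longrightarrow> ((f \<circ> \<gamma>) has_vector_derivative s) (at 0)"
  obtain \<gamma> where "curve_in M p X \<gamma>"
    using assms(1) unfolding tangent_space_def by blast
  then show "s = r"
    using s assms(2) vector_derivative_unique_at by blast
qed (use assms in blast)

lemma deriv_along_extension:
  assumes "X \<in> tangent_space M p" and "open U" "p \<in> U" and "\<And>q. q \<in> U \<inter> M \<Longrightarrow> f q = F q"
    and "(F has_derivative D) (at p)"
  shows "deriv_along M f p X = D X"
  using curve_in_has_vector_derivative[OF _ assms(2-5)] assms(1) by (intro deriv_along_eqI)

text \<open>Along \<open>M\<close> the function is constant, so its derivative in a tangent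
  direction is both \<open>D X\<close> and 0. Every linearised constraint below is obtained this
  way.\<close>

lemma derivative_level_set:
  assumes "X \<in> tangent_space M p" and "open U" "p \<in> U" and "\<And>q. q \<in> U \<inter> M \<Longrightarrow> F q = c"
    and "(F has_derivative D) (at p)"
  shows "D X = 0"
proof -
  have "deriv_along M (\<lambda>_. c) p X = D X"
    using assms by (intro deriv_along_extension[of X M p U _ F]) auto
  moreover have "deriv_along M (\<lambda>_. c) p X = 0"
    using assms(1) by (intro deriv_along_eqI) (auto simp: o_def)
  ultimately show ?thesis
    by simp
qed

text \<open>The derivative of one ambient extension serves all tangent vectors and all curves at
  once, which gives linearity without a vector space structure on the tangent space.\<close>

lemma deriv_along_linear:
  assumes "smooth_map M f" and "p \<in> M"
  obtains D where "linear D"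
    "\<And>X. X \<in> tangent_space M p \<Longrightarrow> deriv_along M f p X = D X"
    "\<And>X \<gamma>. curve_in M p X \<gamma> \<Longrightarrow> ((f \<circ> \<gamma>) has_vector_derivative D X) (at 0)"
proof -
  obtain U F D where U: "open U" "p \<in> U" "\<And>q. q \<in> U \<inter> M \<Longrightarrow> f q = F q"
    "(F has_derivative D) (at p)"
    using smooth_map_extension[OF assms] by metis
  show ?thesis
  proof
    show "linear D"
      using U(4) has_derivative_linear by blast
  qed (use deriv_along_extension[OF _ U] curve_in_has_vector_derivative[OF _ U] in auto)
qed

section \<open>Minkowski space and tangent spaces\<close>

lemma bounded_bilinear_mink: "bounded_bilinear (mink :: 'm::finite mink \<Rightarrow> _)"
proof
  show "\<exists>K. \<forall>a b. norm (mink a b) \<le> norm (a :: 'm mink) * norm b * K"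
  proof (intro exI allI)
    fix a b :: "'m mink"
    have le: "norm (fst c) \<le> norm c" "norm (snd c) \<le> norm c" for c :: "'m mink"
      using norm_fst_le[of "fst c" "snd c"] norm_snd_le[of "snd c" "fst c"] by auto
    have "\<bar>fst a \<bullet> fst b\<bar> \<le> norm a * norm b"
      by (intro order_trans[OF Cauchy_Schwarz_ineq2] mult_mono le) auto
    moreover have "\<bar>snd a * snd b\<bar> \<le> norm a * norm b"
      using le[of a] le[of b] by (auto simp: abs_mult intro!: mult_mono)
    \<comment> \<open>The factor 2 counts the spatial and the last-coordinate term, each bounded by
      the product of the norms.\<close>
    ultimately show "norm (mink a b) \<le> norm a * norm b * 2"
      unfolding mink_def by simp
  qed
qed (auto simp: mink_def inner_simps algebra_simps)

interpretation mink: bounded_bilinear "mink :: 'm::finite mink \<Rightarrow> _"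
  by (rule bounded_bilinear_mink)

lemmas mink_simps = mink.add_left mink.add_right mink.diff_left mink.diff_right
  mink.scaleR_left mink.scaleR_right mink.minus_left mink.minus_right mink.zero_left mink.zero_right

lemma mink_commute: "mink x y = mink y x"
  by (simp add: mink_def inner_commute mult.commute)

lemma mink_nondegenerate:
  assumes "\<And>y. mink x y = 0"
  shows "x = 0"
proof -
  \<comment> \<open>Flipping the last coordinate of the test vector turns the Minkowski form into
    the squared Euclidean norm.\<close>
  have "mink x (fst x, - snd x) = 0"
    by (rule assms)
  then have "fst x \<bullet> fst x + snd x * snd x = 0"
    by (simp add: mink_def)
  then have "fst x \<bullet> fst x = 0 \<and> snd x * snd x = 0"
    using inner_ge_zero[of "fst x"] zero_le_square[of "snd x"] by linarith
  then show ?thesis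
    by (simp add: prod_eq_iff)
qed

section \<open>Tangent spaces of the hyperboloid and of its unit tangent bundle\<close>

lemma T1hyp_iff:
  "(x, v) \<in> T1hyp \<longleftrightarrow> mink x x = -1 \<and> snd x > 0 \<and> mink x v = 0 \<and> mink v v = 1"
  by (auto simp: T1hyp_def hyp_def)

lemma bounded_linear_mink_fst: "bounded_linear (\<lambda>q. mink (fst q) p)"
  and bounded_linear_mink_snd: "bounded_linear (\<lambda>q. mink (snd q) p)"
  by (intro bounded_linear_compose[OF mink.bounded_linear_left] bounded_linear_fst bounded_linear_snd)+

text \<open>As \<open>a\<close> is orthogonal to \<open>x\<close>, the square
  \<open>mink (y t) (y t)\<close> is stationary at 0, so rescaling the curve onto the quadric keeps
  its velocity. The sign \<open>s\<close> is -1 for base points and 1 for unit velocities.\<close>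

lemma normalized_has_vector_derivative:
  assumes "(y has_vector_derivative a) (at 0)" and "y 0 = x"
    and "s * mink x x = 1" and "mink x a = 0"
  shows "((\<lambda>t. (1 / sqrt (s * mink (y t) (y t))) *\<^sub>R y t) has_vector_derivative a) (at (0::real))"
proof -
  have "((\<lambda>t. mink (y t) (y t)) has_vector_derivative mink (y 0) a + mink a (y 0)) (at 0)"
    using assms(1) by (intro mink.has_vector_derivative)
  then have "((\<lambda>t. mink (y t) (y t)) has_real_derivative 0) (at 0)"
    using assms by (simp add: has_real_derivative_iff_has_vector_derivative mink_commute)
  then have "((\<lambda>t. 1 / sqrt (s * mink (y t) (y t))) has_real_derivative 0) (at 0)"
    using assms by (auto intro!: derivative_eq_intros)
  then have "((\<lambda>t. (1 / sqrt (s * mink (y t) (y t))) *\<^sub>R y t) has_vector_derivative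
      ((1 / sqrt (s * mink (y 0) (y 0))) *\<^sub>R a + 0 *\<^sub>R y 0)) (at 0)"
    using assms(1) by (intro has_vector_derivative_scaleR)
  then show ?thesis
    using assms by simp
qed

lemma has_vector_derivative_tendsto_nhds:
  assumes "(y has_vector_derivative a) (at t)"
  shows "(y \<longlongrightarrow> y t) (nhds t)"
  using has_vector_derivative_continuous[OF assms]
  by (simp add: continuous_at tendsto_at_iff_tendsto_nhds)

lemma mink_normalized:
  assumes "s * mink y y > 0"
  shows "mink ((1 / sqrt (s * mink y y)) *\<^sub>R y) ((1 / sqrt (s * mink y y)) *\<^sub>R y) = 1 / s"
  using assms by (cases "s = 0") (auto simp: mink_simps field_simps)

text \<open>Differentiating the quadric equation gives one inclusion. For the other, the straight
  line through \<open>x\<close> with velocity \<open>w\<close> is normalised radially; it stays on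
  the upper sheet for small times.\<close>

lemma tangent_space_hyp:
  assumes "x \<in> hyp"
  shows "tangent_space hyp x = {w. mink x w = 0}"
proof (intro equalityI subsetI CollectI)
  fix w
  assume w: "w \<in> tangent_space hyp x"
  have "((\<lambda>y. mink y y) has_derivative (\<lambda>h. mink x h + mink h x)) (at x)"
    by (intro mink.FDERIV has_derivative_ident)
  from derivative_level_set[OF w open_UNIV UNIV_I _ this, of "-1"]
  show "mink x w = 0"
    by (auto simp: hyp_def mink_commute)
next
  fix w
  assume "w \<in> {w. mink x w = 0}"
  then have w: "mink x w = 0"
    by simp
  have x: "mink x x = -1" "snd x > 0"
    using assms by (auto simp: hyp_def)
  define y where "y t = x + t *\<^sub>R w" for t :: real
  have y0: "y 0 = x"
    by (simp add: y_def)
  have dy: "(y has_vector_derivative w) (at 0)"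
    unfolding y_def by (auto intro!: derivative_eq_intros)
  have lim: "(y \<longlongrightarrow> x) (nhds 0)"
    using has_vector_derivative_tendsto_nhds[OF dy] by (simp add: y0)
  have "((\<lambda>t. mink (y t) (y t)) \<longlongrightarrow> -1) (nhds 0)"
    using mink.tendsto[OF lim lim] by (simp add: x)
  then have ev1: "eventually (\<lambda>t. mink (y t) (y t) < 0) (nhds 0)"
    by (rule order_tendstoD) simp
  have ev2: "eventually (\<lambda>t. 0 < snd (y t)) (nhds 0)"
    using tendsto_snd[OF lim] x by (auto dest: order_tendstoD)
  have "curve_in hyp x w (\<lambda>t. (1 / sqrt (-1 * mink (y t) (y t))) *\<^sub>R y t)"
  proof (rule curve_inI)
    show "eventually (\<lambda>t. (1 / sqrt (-1 * mink (y t) (y t))) *\<^sub>R y t \<in> hyp) (nhds 0)"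
      using ev1 ev2
    proof eventually_elim
      case (elim t)
      then show ?case
        using mink_normalized[of "-1" "y t"] by (simp add: hyp_def)
    qed
  qed (use normalized_has_vector_derivative[OF dy y0, of "-1"] w x y0 in auto)
  then show "w \<in> tangent_space hyp x"
    unfolding tangent_space_def by blast
qed

text \<open>The three equations linearise the three constraints defining \<open>T1hyp\<close>.
  Conversely, straight lines in both components are made orthogonal and then normalised, neither of
  which alters the velocity at 0.\<close>

lemma tangent_space_T1hyp:
  assumes "(x, v) \<in> T1hyp"
  shows "tangent_space T1hyp (x, v) = {(a, b). mink x a = 0 \<and> mink v b = 0 \<and> mink a v + mink x b = 0}"
proof (intro equalityI subsetI)
  fix X
  assume X: "X \<in> tangent_space T1hyp (x, v)"
  obtain a b where ab: "X = (a, b)"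
    by (rule prod.exhaust)
  have "((\<lambda>q. mink (fst q) (fst q)) has_derivative (\<lambda>h. mink x (fst h) + mink (fst h) x)) (at (x, v))"
    by (auto intro!: derivative_eq_intros mink.FDERIV[THEN has_derivative_eq_rhs])
  from derivative_level_set[OF X open_UNIV UNIV_I _ this, of "-1"]
  have 1: "mink x a = 0"
    by (auto simp: ab T1hyp_iff mink_commute)
  have "((\<lambda>q. mink (snd q) (snd q)) has_derivative (\<lambda>h. mink v (snd h) + mink (snd h) v)) (at (x, v))"
    by (auto intro!: derivative_eq_intros mink.FDERIV[THEN has_derivative_eq_rhs])
  from derivative_level_set[OF X open_UNIV UNIV_I _ this, of 1]
  have 2: "mink v b = 0"
    by (auto simp: ab T1hyp_iff mink_commute)
  have "((\<lambda>q. mink (fst q) (snd q)) has_derivative (\<lambda>h. mink x (snd h) + mink (fst h) v)) (at (x, v))"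
    by (auto intro!: derivative_eq_intros mink.FDERIV[THEN has_derivative_eq_rhs])
  from derivative_level_set[OF X open_UNIV UNIV_I _ this, of 0]
  have 3: "mink x b + mink a v = 0"
    by (auto simp: ab T1hyp_iff)
  show "X \<in> {(a, b). mink x a = 0 \<and> mink v b = 0 \<and> mink a v + mink x b = 0}"
    using 1 2 3 by (simp add: ab)
next
  fix X
  assume "X \<in> {(a, b). mink x a = 0 \<and> mink v b = 0 \<and> mink a v + mink x b = 0}"
  then obtain a b where X: "X = (a, b)" and ab: "mink x a = 0" "mink v b = 0" "mink a v + mink x b = 0"
    by auto
  have xv: "mink x x = -1" "snd x > 0" "mink x v = 0" "mink v v = 1"
    using assms by (auto simp: T1hyp_iff)
  define y where "y t = x + t *\<^sub>R a" for t :: real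
  define k where "k t = mink (v + t *\<^sub>R b) (y t) / mink (y t) (y t)" for t
  \<comment> \<open>Gram--Schmidt: project the perturbed velocity onto the complement of the perturbed base point.\<close>
  define u where "u t = v + t *\<^sub>R b - k t *\<^sub>R y t" for t
  have y0: "y 0 = x" and u0: "u 0 = v"
    using xv by (auto simp: y_def u_def k_def mink_commute)
  have dy: "(y has_vector_derivative a) (at 0)"
    unfolding y_def by (auto intro!: derivative_eq_intros)
  have dv: "((\<lambda>t. v + t *\<^sub>R b) has_vector_derivative b) (at 0)"
    by (auto intro!: derivative_eq_intros)
  have 1: "((\<lambda>t. mink (v + t *\<^sub>R b) (y t)) has_real_derivative 0) (at 0)"
    using mink.has_vector_derivative[OF dv dy] ab
    by (simp add: has_real_derivative_iff_has_vector_derivative y0 mink_commute)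
  have 2: "((\<lambda>t. mink (y t) (y t)) has_real_derivative 0) (at 0)"
    using mink.has_vector_derivative[OF dy dy] ab
    by (simp add: has_real_derivative_iff_has_vector_derivative y0 mink_commute)
  \<comment> \<open>The numerator of \<open>k\<close> vanishes at 0, and its derivative there is the
    linearised orthogonality constraint. Hence subtracting \<open>k t *\<^sub>R y t\<close> changes
    neither the value nor the velocity at 0.\<close>
  have dk: "(k has_real_derivative 0) (at 0)"
    unfolding k_def using 1 2 xv by (auto intro!: derivative_eq_intros simp: y0)
  have "(u has_vector_derivative (b - (k 0 *\<^sub>R a + 0 *\<^sub>R y 0))) (at 0)"
    unfolding u_def by (intro has_vector_derivative_diff dv has_vector_derivative_scaleR dk dy)
  then have du: "(u has_vector_derivative b) (at 0)"
    using xv by (simp add: k_def y0 mink_commute)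
  have limy: "(y \<longlongrightarrow> x) (nhds 0)"
    using has_vector_derivative_tendsto_nhds[OF dy] by (simp add: y0)
  have limu: "(u \<longlongrightarrow> v) (nhds 0)"
    using has_vector_derivative_tendsto_nhds[OF du] by (simp add: u0)
  have "((\<lambda>t. mink (y t) (y t)) \<longlongrightarrow> -1) (nhds 0)"
    using mink.tendsto[OF limy limy] by (simp add: xv)
  then have ev1: "eventually (\<lambda>t. mink (y t) (y t) < 0) (nhds 0)"
    by (rule order_tendstoD) simp
  have ev2: "eventually (\<lambda>t. 0 < snd (y t)) (nhds 0)"
    using tendsto_snd[OF limy] xv by (auto dest: order_tendstoD)
  have "((\<lambda>t. mink (u t) (u t)) \<longlongrightarrow> 1) (nhds 0)"
    using mink.tendsto[OF limu limu] by (simp add: xv)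
  then have ev3: "eventually (\<lambda>t. 0 < mink (u t) (u t)) (nhds 0)"
    by (rule order_tendstoD) simp
  have "curve_in T1hyp (x, v) (a, b)
    (\<lambda>t. ((1 / sqrt (-1 * mink (y t) (y t))) *\<^sub>R y t, (1 / sqrt (1 * mink (u t) (u t))) *\<^sub>R u t))"
  proof (rule curve_inI)
    show "eventually (\<lambda>t. ((1 / sqrt (-1 * mink (y t) (y t))) *\<^sub>R y t,
        (1 / sqrt (1 * mink (u t) (u t))) *\<^sub>R u t) \<in> T1hyp) (nhds 0)"
      using ev1 ev2 ev3
    proof eventually_elim
      case (elim t)
      have "mink (y t) (u t) = 0"
        using elim by (simp add: u_def k_def mink_simps mink_commute)
      then show ?case
        using elim mink_normalized[of "-1" "y t"] mink_normalized[of 1 "u t"]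
        by (simp add: T1hyp_iff mink_simps)
    qed
    show "((\<lambda>t. ((1 / sqrt (-1 * mink (y t) (y t))) *\<^sub>R y t, (1 / sqrt (1 * mink (u t) (u t))) *\<^sub>R u t))
        has_vector_derivative (a, b)) (at 0)"
      using ab xv
      by (intro has_vector_derivative_Pair normalized_has_vector_derivative[OF dy y0]
          normalized_has_vector_derivative[OF du u0]) auto
  qed (use xv y0 u0 in auto)
  then show "X \<in> tangent_space T1hyp (x, v)"
    unfolding tangent_space_def X by blast
qed

section \<open>The para-Sasaki tensors in coordinates\<close>

lemma perp_iff:
  assumes "(x, v) \<in> T1hyp"
  shows "w \<in> perp (x, v) \<longleftrightarrow> mink x w = 0 \<and> mink v w = 0"
  using assms by (auto simp: perp_def T1hyp_def tangent_space_hyp mink_commute)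

text \<open>The coefficient of \<open>X\<close> along \<open>flow_gen\<close> must be
  \<open>mink a v\<close>; removing that multiple of \<open>(v, x)\<close> leaves the horizontal and
  vertical parts. The expression \<open>mink a c - mink b d\<close> alone would give
  \<open>flow_gen\<close> squared length 2, and the last term corrects this to 1.\<close>

lemma para_sasaki_eq:
  assumes z: "(x, v) \<in> T1hyp"
    and X: "(a, b) \<in> tangent_space T1hyp (x, v)" and Y: "(c, d) \<in> tangent_space T1hyp (x, v)"
  shows "para_sasaki (x, v) (a, b) (c, d) = mink a c - mink b d - mink a v * mink c v"
  unfolding para_sasaki_def
proof (rule the_equality)
  have xv: "mink x x = -1" "mink x v = 0" "mink v x = 0" "mink v v = 1"
    using z by (auto simp: T1hyp_iff mink_commute)
  have ab: "mink x a = 0" "mink a x = 0" "mink v b = 0" "mink b v = 0" "mink v a = mink a v"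
      "mink x b = - mink a v" "mink b x = - mink a v"
    using X by (auto simp: tangent_space_T1hyp[OF z] mink_commute)
  have cd: "mink x c = 0" "mink c x = 0" "mink v d = 0" "mink d v = 0" "mink v c = mink c v"
      "mink x d = - mink c v" "mink d x = - mink c v"
    using Y by (auto simp: tangent_space_T1hyp[OF z] mink_commute)
  let ?w = "a - mink a v *\<^sub>R v" and ?u = "b - mink a v *\<^sub>R x"
  let ?w' = "c - mink c v *\<^sub>R v" and ?u' = "d - mink c v *\<^sub>R x"
  show "\<exists>r w u s w' u'. {w, u, w', u'} \<subseteq> perp (x, v) \<and>
      (a, b) = r *\<^sub>R flow_gen (x, v) + hor w + vert u \<and>
      (c, d) = s *\<^sub>R flow_gen (x, v) + hor w' + vert u' \<and>
      mink a c - mink b d - mink a v * mink c v = r * s + mink w w' - mink u u'"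
    apply (rule exI[of _ "mink a v"], rule exI[of _ ?w], rule exI[of _ ?u],
        rule exI[of _ "mink c v"], rule exI[of _ ?w'], rule exI[of _ ?u'])
    using xv ab cd by (simp add: perp_iff[OF z] flow_gen_def hor_def vert_def mink_simps)
  fix q
  assume "\<exists>r w u s w' u'. {w, u, w', u'} \<subseteq> perp (x, v) \<and>
      (a, b) = r *\<^sub>R flow_gen (x, v) + hor w + vert u \<and>
      (c, d) = s *\<^sub>R flow_gen (x, v) + hor w' + vert u' \<and>
      q = r * s + mink w w' - mink u u'"
  then obtain r w u s w' u' where perp: "{w, u, w', u'} \<subseteq> perp (x, v)" and
    eq: "(a, b) = r *\<^sub>R flow_gen (x, v) + hor w + vert u"
    "(c, d) = s *\<^sub>R flow_gen (x, v) + hor w' + vert u'"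
    "q = r * s + mink w w' - mink u u'"
    by blast
  have
    "mink x w = 0" "mink v w = 0" "mink x u = 0" "mink v u = 0"
    "mink x w' = 0" "mink v w' = 0" "mink x u' = 0" "mink v u' = 0"
    "a = r *\<^sub>R v + w" "b = r *\<^sub>R x + u" "c = s *\<^sub>R v + w'" "d = s *\<^sub>R x + u'"
    "q = r * s + mink w w' - mink u u'"
    using perp eq by (simp_all add: perp_iff[OF z] flow_gen_def hor_def vert_def)
  then show "q = mink a c - mink b d - mink a v * mink c v"
    using xv by (simp add: mink_simps mink_commute[of w v] mink_commute[of w' v]
        mink_commute[of u x] mink_commute[of u' x])
qed

lemma flow_gen_tangent:
  assumes "(x, v) \<in> T1hyp"
  shows "(v, x) \<in> tangent_space T1hyp (x, v)"
  using assms by (auto simp: tangent_space_T1hyp T1hyp_iff mink_commute)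

text \<open>Pairing with \<open>(v, x)\<close> produces \<open>mink a v\<close> three times, since
  \<open>mink b x = - mink a v\<close> by tangency; two copies cancel.\<close>

lemma conn_form_eq:
  assumes "(x, v) \<in> T1hyp" and "(a, b) \<in> tangent_space T1hyp (x, v)"
  shows "conn_form (x, v) (a, b) = mink a v"
proof -
  have "mink v v = 1" "mink b x = - mink a v"
    using assms mink_commute[of x b] by (simp_all add: tangent_space_T1hyp T1hyp_iff)
  then show ?thesis
    using para_sasaki_eq[OF assms flow_gen_tangent[OF assms(1)]]
    by (simp add: conn_form_def flow_gen_def)
qed

text \<open>Once the component along the flow vanishes, the mixed tangency equation splits into two
  separate orthogonality relations.\<close>

lemma chi_perp_iff:
  assumes "(x, v) \<in> T1hyp"
  shows "(a, b) \<in> chi_perp (x, v) \<longleftrightarrow> mink x a = 0 \<and> mink v a = 0 \<and> mink x b = 0 \<and> mink v b = 0"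
proof -
  have "(a, b) \<in> chi_perp (x, v) \<longleftrightarrow> (a, b) \<in> tangent_space T1hyp (x, v) \<and> mink a v = 0"
    using conn_form_eq[OF assms, of a b] by (simp add: chi_perp_def conn_form_def cong: conj_cong)
  then show ?thesis
    using mink_commute[of a v] by (auto simp: tangent_space_T1hyp[OF assms])
qed

lemma chi_perp_tangent: "X \<in> chi_perp z \<Longrightarrow> X \<in> tangent_space T1hyp z"
  by (simp add: chi_perp_def)

lemma para_sasaki_chi_perp:
  assumes z: "z \<in> T1hyp" and "X \<in> chi_perp z" "Y \<in> chi_perp z"
  shows "para_sasaki z X Y = mink (fst X) (fst Y) - mink (snd X) (snd Y)"
proof -
  obtain x v a b c d where eq: "z = (x, v)" "X = (a, b)" "Y = (c, d)"
    by (metis surj_pair)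
  have "mink a v = 0"
    using assms chi_perp_iff[of x v a b] by (simp add: eq mink_commute)
  then show ?thesis
    using para_sasaki_eq[of x v a b c d] assms by (simp add: eq chi_perp_tangent)
qed

lemma para_J_eq:
  assumes "z \<in> T1hyp" and "X \<in> chi_perp z"
  shows "para_J z X = prod.swap X"
proof -
  obtain x v a b where eq: "z = (x, v)" "X = (a, b)"
    by (metis surj_pair)
  have "{a, b} \<subseteq> perp (x, v)"
    using assms by (simp add: eq chi_perp_iff perp_iff)
  then show ?thesis
    unfolding para_J_def eq by (intro the_equality) (simp_all add: hor_def vert_def del: split_paired_Ex)
qed

lemma chi_perp_swap:
  assumes "z \<in> T1hyp" and "X \<in> chi_perp z"
  shows "prod.swap X \<in> chi_perp z"
proof -
  obtain x v a b where eq: "z = (x, v)" "X = (a, b)"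
    by (metis surj_pair)
  show ?thesis
    using assms by (auto simp: eq chi_perp_iff)
qed

section \<open>The geodesic flow\<close>

lemma geod_flow_eq: "geod_flow t (x, v) = (cosh t *\<^sub>R x + sinh t *\<^sub>R v, sinh t *\<^sub>R x + cosh t *\<^sub>R v)"
  by (simp add: geod_flow_def)

lemma bounded_linear_geod_flow: "bounded_linear (geod_flow t)"
  unfolding geod_flow_def split_def
  by (intro bounded_linear_Pair bounded_linear_add bounded_linear_const_scaleR
      bounded_linear_fst bounded_linear_snd)

lemma geod_flow_0: "geod_flow 0 z = z"
  by (simp add: geod_flow_def split_def)

lemma geod_flow_add: "geod_flow s (geod_flow t z) = geod_flow (s + t) z"
  by (simp add: geod_flow_def split_def cosh_add sinh_add algebra_simps)

lemma cosh_sinh_square: "cosh t * cosh t - sinh t * sinh t = (1::real)"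
  using hyperbolic_pythagoras[of t] by (simp add: power2_eq_square)

lemma abs_sinh_less_cosh: "\<bar>sinh t\<bar> < cosh (t :: real)"
proof (rule power2_less_imp_less)
  show "\<bar>sinh t\<bar>\<^sup>2 < (cosh t)\<^sup>2"
    unfolding power2_abs using hyperbolic_pythagoras[of t] by linarith
qed (simp add: less_imp_le)

text \<open>Cauchy-Schwarz for the spatial parts reduces to
  \<open>(snd v)\<^sup>2 + 1 \<le> (snd x)\<^sup>2\<close>. Together with
  \<open>abs_sinh_less_cosh\<close> this keeps the flow on the upper sheet.\<close>

lemma T1hyp_snd_less:
  assumes "(x, v) \<in> T1hyp"
  shows "\<bar>snd v\<bar> < snd x"
proof (rule power2_less_imp_less)
  have xv: "fst x \<bullet> fst x = (snd x)\<^sup>2 - 1" "fst v \<bullet> fst v = (snd v)\<^sup>2 + 1" "fst x \<bullet> fst v = snd x * snd v"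
    using assms by (auto simp: T1hyp_iff mink_def power2_eq_square)
  have "(fst x \<bullet> fst v)\<^sup>2 \<le> (fst x \<bullet> fst x) * (fst v \<bullet> fst v)"
    by (rule Cauchy_Schwarz_ineq)
  then show "\<bar>snd v\<bar>\<^sup>2 < (snd x)\<^sup>2"
    unfolding xv by (simp add: power_mult_distrib algebra_simps)
qed (use assms in \<open>simp add: T1hyp_iff\<close>)

lemma geod_flow_T1hyp:
  assumes "z \<in> T1hyp"
  shows "geod_flow t z \<in> T1hyp"
proof -
  obtain x v where z: "z = (x, v)"
    by (metis surj_pair)
  have xv: "mink x x = -1" "snd x > 0" "mink x v = 0" "mink v x = 0" "mink v v = 1"
    using assms by (auto simp: z T1hyp_iff mink_commute)
  have "\<bar>sinh t * snd v\<bar> < cosh t * snd x"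
    using T1hyp_snd_less[of x v] assms abs_sinh_less_cosh[of t] unfolding z abs_mult
    by (intro mult_strict_mono) auto
  then have "0 < cosh t * snd x + sinh t * snd v"
    by linarith
  \<comment> \<open>With free coefficients one formula serves twice: exchanging \<open>c\<close> and
    \<open>s\<close> turns the square of the base point into that of the velocity.\<close>
  moreover have "mink (c *\<^sub>R x + s *\<^sub>R v) (c *\<^sub>R x + s *\<^sub>R v) = s * s - c * c"
    and "mink (c *\<^sub>R x + s *\<^sub>R v) (s *\<^sub>R x + c *\<^sub>R v) = 0" for c s
    using xv by (simp_all add: mink_simps)
  moreover have "sinh t * sinh t = cosh t * cosh t - 1"
    using cosh_sinh_square[of t] by linarith
  ultimately show ?thesis
    by (simp add: z geod_flow_eq T1hyp_iff)
qed

lemma geod_flow_chi_perp: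
  assumes "z \<in> T1hyp" and "X \<in> chi_perp z"
  shows "geod_flow t X \<in> chi_perp (geod_flow t z)"
proof -
  obtain x v a b where eq: "z = (x, v)" "X = (a, b)"
    by (metis surj_pair)
  have "geod_flow t (x, v) \<in> T1hyp"
    using assms eq geod_flow_T1hyp by blast
  then show ?thesis
    using assms unfolding eq geod_flow_eq by (simp add: chi_perp_iff mink_simps)
qed

text \<open>This is the flow invariance of J, which on \<open>chi_perp\<close> exchanges the two
  components.\<close>

lemma geod_flow_swap: "geod_flow t (prod.swap X) = prod.swap (geod_flow t X)"
  by (cases X) (simp add: geod_flow_eq add.commute)

lemma para_sasaki_geod_flow:
  assumes "z \<in> T1hyp" and "X \<in> chi_perp z" "Y \<in> chi_perp z"
  shows "para_sasaki (geod_flow t z) (geod_flow t X) (geod_flow t Y) = para_sasaki z X Y"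
proof -
  \<comment> \<open>Here \<open>A\<close> and \<open>D\<close> stand for \<open>mink a c\<close> and
    \<open>mink b d\<close>, while \<open>B\<close> and \<open>C\<close> are the mixed products,
    which cancel.\<close>
  have alg: "c * (c * A + s * B) + s * (c * C + s * D) - (s * (s * A + c * B) + c * (s * C + c * D)) = A - D"
    if "c * c - s * s = 1" for A B C D c s :: real
  proof -
    have "c * (c * A + s * B) + s * (c * C + s * D) - (s * (s * A + c * B) + c * (s * C + c * D))
        = (c * c - s * s) * (A - D)"
      by (simp add: algebra_simps)
    then show ?thesis
      using that by simp
  qed
  obtain a b c d where eq: "X = (a, b)" "Y = (c, d)"
    by (metis surj_pair)
  have "para_sasaki (geod_flow t z) (geod_flow t X) (geod_flow t Y) =
      mink (fst (geod_flow t X)) (fst (geod_flow t Y)) - mink (snd (geod_flow t X)) (snd (geod_flow t Y))"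
    using assms by (intro para_sasaki_chi_perp geod_flow_T1hyp geod_flow_chi_perp)
  also have "\<dots> = mink a c - mink b d"
    using alg[OF cosh_sinh_square[of t]] by (simp add: eq geod_flow_eq mink_simps)
  also have "\<dots> = para_sasaki z X Y"
    using para_sasaki_chi_perp[OF assms] by (simp add: eq)
  finally show ?thesis .
qed

text \<open>The flow at a fixed time is linear in the ambient space and therefore its own
  differential.\<close>

lemma geod_flow_curve_in:
  assumes "curve_in T1hyp z X \<gamma>"
  shows "curve_in T1hyp (geod_flow t z) (geod_flow t X) (geod_flow t \<circ> \<gamma>)"
proof -
  have "((\<lambda>s. geod_flow t (\<gamma> s)) has_vector_derivative geod_flow t X) (at 0)"
    using assms bounded_linear.has_vector_derivative[OF bounded_linear_geod_flow]
    unfolding curve_in_def by blast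
  then show ?thesis
    using assms geod_flow_T1hyp unfolding curve_in_def o_def by blast
qed

lemma geod_flow_has_vector_derivative:
  "((\<lambda>t. geod_flow t z) has_vector_derivative flow_gen (geod_flow t z)) (at t)"
proof -
  have "((\<lambda>t. cosh t *\<^sub>R x + sinh t *\<^sub>R v) has_vector_derivative sinh t *\<^sub>R x + cosh t *\<^sub>R v) (at t)"
    and "((\<lambda>t. sinh t *\<^sub>R x + cosh t *\<^sub>R v) has_vector_derivative cosh t *\<^sub>R x + sinh t *\<^sub>R v) (at t)"
    for x v :: "'a mink"
    by (intro has_vector_derivative_add bounded_linear.has_vector_derivative[OF bounded_linear_scaleR_left]
        has_real_derivative_iff_has_vector_derivative[THEN iffD1];
      auto intro!: derivative_eq_intros)+
  note d = has_vector_derivative_Pair[OF this]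
  obtain x v where z: "z = (x, v)"
    by (metis surj_pair)
  show ?thesis
    unfolding z geod_flow_eq flow_gen_def prod.case by (rule d)
qed

lemma flow_gen_curve_in:
  "z \<in> T1hyp \<Longrightarrow> curve_in T1hyp z (flow_gen z) (\<lambda>t. geod_flow t z)"
  using geod_flow_has_vector_derivative[of z 0]
  by (simp add: curve_in_def geod_flow_0 geod_flow_T1hyp gt_ex)

section \<open>Geodesics\<close>

lemma vector_derivative_const_imp_eq:
  fixes f :: "real \<Rightarrow> 'a::real_normed_vector"
  assumes "\<And>t. (f has_vector_derivative 0) (at t)"
  shows "f t = f 0"
proof -
  have "(f has_derivative (\<lambda>_. 0)) (at t within UNIV)" for t
    using assms[of t] by (simp add: has_vector_derivative_def)
  then obtain c where "\<And>x. f x = c"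
    using has_derivative_zero_constant[of UNIV f] by auto
  then show ?thesis
    by simp
qed

text \<open>Multiplying by the integrating factor \<open>exp (- k * t)\<close> gives a curve with
  zero derivative.\<close>

lemma vector_ode_exp:
  fixes f :: "real \<Rightarrow> 'a::real_normed_vector"
  assumes "\<And>t. (f has_vector_derivative k *\<^sub>R f t) (at t)"
  shows "f t = exp (k * t) *\<^sub>R f 0"
proof -
  have "((\<lambda>t. exp (- k * t) *\<^sub>R f t) has_vector_derivative 0) (at t)" for t
  proof -
    have "((\<lambda>t. exp (- k * t)) has_real_derivative exp (- k * t) * (- k)) (at t)"
      by (auto intro!: derivative_eq_intros)
    from has_vector_derivative_scaleR[OF this assms[of t]] show ?thesis
      by (simp add: algebra_simps)
  qed
  from vector_derivative_const_imp_eq[OF this] have "exp (- k * t) *\<^sub>R f t = f 0"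
    by simp
  then have "exp (k * t) *\<^sub>R exp (- k * t) *\<^sub>R f t = exp (k * t) *\<^sub>R f 0"
    by simp
  then show ?thesis
    by (simp add: exp_minus)
qed

text \<open>A vector normal to the hyperboloid at \<open>p\<close> is a multiple of
  \<open>p\<close>, and its product with \<open>p\<close> fixes the multiple.\<close>

lemma geodesic_acceleration:
  assumes p: "p \<in> hyp" and w: "\<forall>w\<in>tangent_space hyp p. mink y w = 0" and y: "mink p y = -1"
  shows "y = p"
proof -
  have pp: "mink p p = -1"
    using p by (simp add: hyp_def)
  have "mink (y - p) u = 0" for u
  proof -
    \<comment> \<open>This is the tangential projection of \<open>u\<close>; the sign is plus
      because \<open>mink p p = -1\<close>.\<close>
    have "u + mink p u *\<^sub>R p \<in> tangent_space hyp p"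
      using pp by (simp add: tangent_space_hyp[OF p] mink_simps)
    with w have "mink y (u + mink p u *\<^sub>R p) = 0"
      by blast
    then show ?thesis
      using y by (simp add: mink_simps mink_commute)
  qed
  then have "y - p = 0"
    by (rule mink_nondegenerate)
  then show ?thesis
    by simp
qed

text \<open>Differentiating \<open>mink (\<gamma> t) (\<gamma> t) = -1\<close> twice and using unit
  speed gives \<open>mink (\<gamma> t) (\<gamma>'' t) = -1\<close>. As the acceleration is normal,
  it equals the position.\<close>

lemma geodesic_eq_flow:
  assumes "geodesic \<gamma>" and "\<gamma> 0 = x" and "(\<gamma> has_vector_derivative v) (at 0)"
  shows "\<gamma> t = fst (geod_flow t (x, v))"
proof -
  obtain \<gamma>' \<gamma>'' where hyp: "\<And>t. \<gamma> t \<in> hyp"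
    and d1: "\<And>t. (\<gamma> has_vector_derivative \<gamma>' t) (at t)"
    and d2: "\<And>t. (\<gamma>' has_vector_derivative \<gamma>'' t) (at t)"
    and unit: "\<And>t. mink (\<gamma>' t) (\<gamma>' t) = 1"
    and acc: "\<And>t. \<forall>w\<in>tangent_space hyp (\<gamma> t). mink (\<gamma>'' t) w = 0"
    using assms(1) unfolding geodesic_def by blast
  have norm: "mink (\<gamma> t) (\<gamma> t) = -1" for t
    using hyp by (simp add: hyp_def)
  have orth: "mink (\<gamma> t) (\<gamma>' t) = 0" for t
  proof -
    have "((\<lambda>t. -1) has_vector_derivative mink (\<gamma> t) (\<gamma>' t) + mink (\<gamma>' t) (\<gamma> t)) (at t)"
      using mink.has_vector_derivative[OF d1 d1, of t] by (simp add: norm)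
    from vector_derivative_unique_at[OF this has_vector_derivative_const]
    show ?thesis
      by (simp add: mink_commute)
  qed
  have "mink (\<gamma> t) (\<gamma>'' t) = -1" for t
  proof -
    have "((\<lambda>t. 0) has_vector_derivative mink (\<gamma> t) (\<gamma>'' t) + mink (\<gamma>' t) (\<gamma>' t)) (at t)"
      using mink.has_vector_derivative[OF d1 d2, of t] by (simp add: orth)
    from vector_derivative_unique_at[OF this has_vector_derivative_const]
    show ?thesis
      using unit by simp
  qed
  then have eq: "\<gamma>'' t = \<gamma> t" for t
    using geodesic_acceleration[OF hyp acc] by blast
  have v: "\<gamma>' 0 = v"
    using vector_derivative_unique_at[OF d1 assms(3)] .
  \<comment> \<open>The equation \<open>\<gamma>'' = \<gamma>\<close> decouples into first-order
    equations for the sum and the difference of position and velocity, with rates 1 and -1.\<close>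
  have "((\<lambda>t. \<gamma> t + \<gamma>' t) has_vector_derivative 1 *\<^sub>R (\<gamma> t + \<gamma>' t)) (at t)" for t
    using has_vector_derivative_add[OF d1 d2, of t] by (simp add: eq add.commute)
  from vector_ode_exp[OF this] have plus: "\<gamma> t + \<gamma>' t = exp t *\<^sub>R (x + v)"
    by (simp add: assms(2) v)
  have "((\<lambda>t. \<gamma> t - \<gamma>' t) has_vector_derivative (-1) *\<^sub>R (\<gamma> t - \<gamma>' t)) (at t)" for t
    using has_vector_derivative_diff[OF d1 d2, of t] by (simp add: eq)
  from vector_ode_exp[OF this] have minus: "\<gamma> t - \<gamma>' t = exp (- t) *\<^sub>R (x - v)"
    by (simp add: assms(2) v)
  have "\<gamma> t = (1 / 2) *\<^sub>R ((\<gamma> t + \<gamma>' t) + (\<gamma> t - \<gamma>' t))"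
    by (simp flip: scaleR_2)
  also have "\<dots> = fst (geod_flow t (x, v))"
    unfolding plus minus geod_flow_eq cosh_def sinh_def by (simp add: algebra_simps)
  finally show ?thesis .
qed

lemma geodesic_flow:
  assumes "z \<in> T1hyp"
  shows "geodesic (\<lambda>t. fst (geod_flow t z))"
  unfolding geodesic_def
proof (intro conjI allI exI)
  fix t
  obtain x v where z: "geod_flow t z = (x, v)"
    by (metis surj_pair)
  then have xv: "(x, v) \<in> T1hyp"
    using geod_flow_T1hyp[OF assms, of t] by simp
  show "fst (geod_flow t z) \<in> hyp"
    using xv by (simp add: z T1hyp_def)
  have d: "((\<lambda>t. geod_flow t z) has_vector_derivative (v, x)) (at t)"
    using geod_flow_has_vector_derivative[of z t] by (simp add: z flow_gen_def)
  show "((\<lambda>t. fst (geod_flow t z)) has_vector_derivative snd (geod_flow t z)) (at t)"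
    using bounded_linear.has_vector_derivative[OF bounded_linear_fst d] by (simp add: z)
  show "((\<lambda>t. snd (geod_flow t z)) has_vector_derivative fst (geod_flow t z)) (at t)"
    using bounded_linear.has_vector_derivative[OF bounded_linear_snd d] by (simp add: z)
  show "mink (snd (geod_flow t z)) (snd (geod_flow t z)) = 1"
    using xv by (simp add: z T1hyp_iff)
  show "\<forall>w\<in>tangent_space hyp (fst (geod_flow t z)). mink (fst (geod_flow t z)) w = 0"
    using xv by (simp add: z T1hyp_def tangent_space_hyp)
qed

lemma fst_geod_flow_has_vector_derivative:
  "((\<lambda>t. fst (geod_flow t z)) has_vector_derivative snd (geod_flow t z)) (at t)"
  using bounded_linear.has_vector_derivative[OF bounded_linear_fst geod_flow_has_vector_derivative]
  by (simp add: flow_gen_def split_def)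

lemma geodesic_shift:
  assumes "geodesic \<gamma>"
  shows "geodesic (\<lambda>t. \<gamma> (t + s))"
proof -
  obtain \<gamma>' \<gamma>'' where "\<And>t. \<gamma> t \<in> hyp"
    and *: "\<And>t. (\<gamma> has_vector_derivative \<gamma>' t) (at t) \<and>
        (\<gamma>' has_vector_derivative \<gamma>'' t) (at t) \<and>
        mink (\<gamma>' t) (\<gamma>' t) = 1 \<and>
        (\<forall>w\<in>tangent_space hyp (\<gamma> t). mink (\<gamma>'' t) w = 0)"
    using assms unfolding geodesic_def by blast
  have shift: "((\<lambda>t. f (t + s)) has_vector_derivative D) (at t)"
    if "(f has_vector_derivative D) (at (t + s))" for f :: "real \<Rightarrow> 'a mink" and D t
  proof -
    have "((\<lambda>t. t + s) has_real_derivative 1) (at t)"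
      by (auto intro!: derivative_eq_intros)
    then show ?thesis
      using vector_diff_chain_at[of "\<lambda>t. t + s" 1 t f D] that
      by (simp add: has_real_derivative_iff_has_vector_derivative o_def)
  qed
  show ?thesis
    unfolding geodesic_def
    using \<open>\<And>t. \<gamma> t \<in> hyp\<close> *
    by (intro conjI allI exI[of _ "\<lambda>t. \<gamma>' (t + s)"] exI[of _ "\<lambda>t. \<gamma>'' (t + s)"] shift) blast+
qed

section \<open>The projection to the space of geodesics and its fibres\<close>

lemma unparam_shift: "unparam (\<lambda>t. \<gamma> (t + s)) = unparam \<gamma>"
proof -
  have "(\<lambda>t. \<gamma> (t + r)) = (\<lambda>t. \<gamma> (t + (r - s) + s))"
    and "(\<lambda>t. \<gamma> (t + r + s)) = (\<lambda>t. \<gamma> (t + (r + s)))" for r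
    by (simp_all add: add.assoc)
  then show ?thesis
    unfolding unparam_def by blast
qed

text \<open>Every member of a class is again a geodesic and generates that class. A member with
  initial data \<open>(x, v)\<close> must be the flow line, so the class is determined.\<close>

lemma geod_proj_eq:
  assumes "z \<in> T1hyp"
  shows "geod_proj z = unparam (\<lambda>t. fst (geod_flow t z))"
proof -
  obtain x v where z: "z = (x, v)"
    by (metis surj_pair)
  let ?c = "\<lambda>t. fst (geod_flow t z)"
  have c: "?c 0 = x" "(?c has_vector_derivative v) (at 0)"
    using fst_geod_flow_has_vector_derivative[of z 0] by (simp_all add: z geod_flow_0)
  have "?c = (\<lambda>t. ?c (t + 0))"
    by simp
  then have mem: "?c \<in> unparam ?c"
    unfolding unparam_def by blast
  show ?thesis
    unfolding geod_proj_def z prod.case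
  proof (rule the_equality, unfold z[symmetric])
    show "unparam ?c \<in> geod_space \<and>
        (\<exists>\<gamma>\<in>unparam ?c. \<gamma> 0 = x \<and> (\<gamma> has_vector_derivative v) (at 0))"
      using geodesic_flow[OF assms] c unfolding geod_space_def
      by (intro conjI bexI[OF _ mem]) blast+
    fix l
    assume "l \<in> geod_space \<and> (\<exists>\<gamma>\<in>l. \<gamma> 0 = x \<and> (\<gamma> has_vector_derivative v) (at 0))"
    then obtain \<gamma>0 \<gamma> s where "geodesic \<gamma>0" "l = unparam \<gamma>0" and \<gamma>: "\<gamma> = (\<lambda>t. \<gamma>0 (t + s))"
      "\<gamma> 0 = x" "(\<gamma> has_vector_derivative v) (at 0)"
      unfolding geod_space_def unparam_def by blast
    then have "geodesic \<gamma>" "l = unparam \<gamma>"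
      using geodesic_shift unparam_shift by metis+
    moreover from \<open>geodesic \<gamma>\<close> have "\<gamma> = ?c"
      using geodesic_eq_flow[OF _ \<gamma>(2,3)] by (intro ext) (simp add: z)
    ultimately show "l = unparam ?c"
      by simp
  qed
qed

lemma geod_proj_geod_flow:
  assumes "z \<in> T1hyp"
  shows "geod_proj (geod_flow s z) = geod_proj z"
  using unparam_shift[of "\<lambda>t. fst (geod_flow t z)" s] assms
  by (simp add: geod_proj_eq geod_flow_T1hyp geod_flow_add)

lemma geod_proj_fibre:
  assumes "z \<in> T1hyp" "z' \<in> T1hyp" and "geod_proj z' = geod_proj z"
  obtains s where "z' = geod_flow s z"
proof -
  let ?c = "\<lambda>t. fst (geod_flow t z)" and ?c' = "\<lambda>t. fst (geod_flow t z')"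
  have "?c' = (\<lambda>t. ?c' (t + 0))"
    by simp
  then have "?c' \<in> unparam ?c'"
    unfolding unparam_def by blast
  then have "?c' \<in> unparam ?c"
    using assms by (simp add: geod_proj_eq)
  then obtain s where s: "?c' = (\<lambda>t. ?c (t + s))"
    unfolding unparam_def by blast
  then have eq: "(\<lambda>t. fst (geod_flow t z')) = (\<lambda>t. fst (geod_flow t (geod_flow s z)))"
    by (simp add: geod_flow_add)
  have "fst (geod_flow 0 z') = fst (geod_flow 0 (geod_flow s z))"
    using fun_cong[OF eq, of 0] .
  \<comment> \<open>Equality of the base curves for all times also determines the velocity, as their
    derivative at 0.\<close>
  moreover have "snd (geod_flow 0 z') = snd (geod_flow 0 (geod_flow s z))"
    using fst_geod_flow_has_vector_derivative[of z' 0, unfolded eq]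
      fst_geod_flow_has_vector_derivative[of "geod_flow s z" 0]
    by (rule vector_derivative_unique_at)
  ultimately have "z' = geod_flow s z"
    by (simp add: geod_flow_0 prod_eq_iff)
  then show ?thesis
    by (rule that)
qed

section \<open>Tensors on the space of geodesics\<close>

text \<open>A curve through \<open>z\<close> and its image under the flow project to the same curve
  of geodesics, so every smooth function has the same derivative along both.\<close>

lemma d_proj_geod_flow:
  assumes "z \<in> T1hyp" and "X \<in> tangent_space T1hyp z"
  shows "d_proj (geod_flow t z) (geod_flow t X) = d_proj z X"
proof
  fix f
  show "d_proj (geod_flow t z) (geod_flow t X) f = d_proj z X f"
  proof (cases "smooth_geod f")
    case True
    let ?F = "f \<circ> geod_proj"
    have smooth: "smooth_map T1hyp ?F"
      using True unfolding smooth_geod_def .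
    obtain D where D: "deriv_along T1hyp ?F z X = D X"
        "\<And>\<gamma>. curve_in T1hyp z X \<gamma> \<Longrightarrow> ((?F \<circ> \<gamma>) has_vector_derivative D X) (at 0)"
      using deriv_along_linear[OF smooth assms(1)] assms(2) by metis
    obtain \<gamma> where \<gamma>: "curve_in T1hyp z X \<gamma>"
      using assms(2) unfolding tangent_space_def by blast
    note \<gamma>' = geod_flow_curve_in[OF \<gamma>, of t]
    then have tang: "geod_flow t X \<in> tangent_space T1hyp (geod_flow t z)"
      unfolding tangent_space_def by blast
    obtain D' where D': "deriv_along T1hyp ?F (geod_flow t z) (geod_flow t X) = D' (geod_flow t X)"
        "((?F \<circ> (geod_flow t \<circ> \<gamma>)) has_vector_derivative D' (geod_flow t X)) (at 0)"
      using deriv_along_linear[OF smooth geod_flow_T1hyp[OF assms(1)]] tang \<gamma>' by metis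
    have "eventually (\<lambda>s. (?F \<circ> (geod_flow t \<circ> \<gamma>)) s = (?F \<circ> \<gamma>) s) (nhds 0)"
      using curve_in_eventually[OF \<gamma>] by eventually_elim (simp add: geod_proj_geod_flow)
    from has_vector_derivative_cong_nhds[OF this D'(2)] D(2)[OF \<gamma>]
    have "D' (geod_flow t X) = D X"
      by (rule vector_derivative_unique_at)
    then show ?thesis
      using True by (simp add: d_proj_def D(1) D'(1))
  qed (simp add: d_proj_def)
qed

lemma horizontal_part:
  assumes "z \<in> T1hyp" and "X \<in> tangent_space T1hyp z"
  shows "X - conn_form z X *\<^sub>R flow_gen z \<in> chi_perp z"
proof -
  obtain x v a b where eq: "z = (x, v)" "X = (a, b)"
    by (metis surj_pair)
  note z = assms(1)[unfolded eq] and X = assms(2)[unfolded eq]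
  have "mink x x = -1" "mink x v = 0" "mink v v = 1"
    using z by (simp_all add: T1hyp_iff)
  moreover have "mink x a = 0" "mink v b = 0" "mink x b = - mink a v" "mink v a = mink a v"
    using X by (simp_all add: tangent_space_T1hyp[OF z] mink_commute)
  ultimately have "(a - mink a v *\<^sub>R v, b - mink a v *\<^sub>R x) \<in> chi_perp (x, v)"
    unfolding chi_perp_iff[OF z] by (simp add: mink_simps mink_commute[of v x])
  then show ?thesis
    unfolding eq conn_form_eq[OF z X] by (simp add: flow_gen_def)
qed

text \<open>The flow line through \<open>z\<close> lies in a single fibre, where
  \<open>f \<circ> geod_proj\<close> is constant. Its derivative thus kills
  \<open>flow_gen z\<close>, and linearity does the rest.\<close>

lemma d_proj_horizontal_part:
  assumes "z \<in> T1hyp" and "X \<in> tangent_space T1hyp z"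
  shows "d_proj z (X - conn_form z X *\<^sub>R flow_gen z) = d_proj z X"
proof
  fix f
  let ?X = "X - conn_form z X *\<^sub>R flow_gen z"
  show "d_proj z ?X f = d_proj z X f"
  proof (cases "smooth_geod f")
    case True
    let ?F = "f \<circ> geod_proj"
    from True have smooth: "smooth_map T1hyp ?F"
      unfolding smooth_geod_def .
    obtain D where "linear D"
      and D: "\<And>X. X \<in> tangent_space T1hyp z \<Longrightarrow> deriv_along T1hyp ?F z X = D X"
        "\<And>X \<gamma>. curve_in T1hyp z X \<gamma> \<Longrightarrow> ((?F \<circ> \<gamma>) has_vector_derivative D X) (at 0)"
      using deriv_along_linear[OF smooth assms(1)] by metis
    have "?F \<circ> (\<lambda>t. geod_flow t z) = (\<lambda>_. ?F z)"
      using assms(1) by (simp add: o_def geod_proj_geod_flow)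
    then have "D (flow_gen z) = 0"
      using D(2)[OF flow_gen_curve_in[OF assms(1)]] vector_derivative_unique_at has_vector_derivative_const
      by metis
    then have "D ?X = D X"
      using \<open>linear D\<close> by (simp add: linear_diff linear_scale)
    then show ?thesis
      using True D(1) assms chi_perp_tangent[OF horizontal_part[OF assms]] by (simp add: d_proj_def)
  qed (simp add: d_proj_def)
qed

text \<open>Pluecker coordinates descend to the space of geodesics and provide enough smooth functions there
  to separate tangent vectors.\<close>

definition pluecker :: "'m::finite mink \<Rightarrow> 'm mink \<Rightarrow> 'm mink \<times> 'm mink \<Rightarrow> real" where
  "pluecker p q z = mink (fst z) p * mink (snd z) q - mink (fst z) q * mink (snd z) p"

text \<open>The flow acts on the plane spanned by base point and velocity with determinant
  \<open>cosh t * cosh t - sinh t * sinh t\<close>, which is 1.\<close>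

lemma pluecker_geod_flow: "pluecker p q (geod_flow t z) = pluecker p q z"
proof -
  obtain x v where z: "z = (x, v)"
    by (metis surj_pair)
  have "pluecker p q (geod_flow t z) = (cosh t * cosh t - sinh t * sinh t) * pluecker p q z"
    by (simp add: pluecker_def z geod_flow_eq mink_simps algebra_simps)
  then show ?thesis
    by (simp add: cosh_sinh_square)
qed

lemma pluecker_test_function:
  fixes p q :: "'m::finite mink"
  obtains f where "smooth_geod f"
    "\<And>x v a b. (x, v) \<in> T1hyp \<Longrightarrow> (a, b) \<in> tangent_space T1hyp (x, v) \<Longrightarrow>
      d_proj (x, v) (a, b) f =
        mink a p * mink v q + mink x p * mink b q - (mink a q * mink v p + mink x q * mink b p)"
proof
  \<comment> \<open>An arbitrary representative of the fibre may be chosen, because Pluecker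
    coordinates are constant along the flow and fibres are flow orbits.\<close>
  define f :: "'m ogeod \<Rightarrow> real" where "f l = pluecker p q (SOME z. z \<in> T1hyp \<and> geod_proj z = l)" for l
  have f: "(f \<circ> geod_proj) z = pluecker p q z" if z: "z \<in> T1hyp" for z
  proof -
    let ?z = "SOME z'. z' \<in> T1hyp \<and> geod_proj z' = geod_proj z"
    have "?z \<in> T1hyp \<and> geod_proj ?z = geod_proj z"
      by (rule someI[of "\<lambda>z'. z' \<in> T1hyp \<and> geod_proj z' = geod_proj z" z]) (simp add: z)
    then obtain s where s: "?z = geod_flow s z"
      using geod_proj_fibre[OF z, of ?z] by blast
    show ?thesis
      unfolding o_def f_def s by (rule pluecker_geod_flow)
  qed
  have "smooth_map T1hyp (pluecker p q)"
    unfolding pluecker_def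
    by (intro smooth_map_of_Ck_on_UNIV Ck_on_diff Ck_on_bilinear[OF bounded_bilinear_mult]
        Ck_on_bounded_linear[OF bounded_linear_mink_fst]
        Ck_on_bounded_linear[OF bounded_linear_mink_snd] open_UNIV)
  then show smooth: "smooth_geod f"
    unfolding smooth_geod_def using f by (rule smooth_map_cong)
  fix x v a b :: "'m mink"
  assume X: "(a, b) \<in> tangent_space T1hyp (x, v)"
  have "(pluecker p q has_derivative
      (\<lambda>h. mink x p * mink (snd h) q + mink (fst h) p * mink v q
        - (mink x q * mink (snd h) p + mink (fst h) q * mink v p))) (at (x, v))"
    unfolding pluecker_def
    by (intro has_derivative_diff has_derivative_mult[THEN has_derivative_eq_rhs])
      (auto intro!: bounded_linear_imp_has_derivative bounded_linear_mink_fst bounded_linear_mink_snd)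
  from deriv_along_extension[OF X open_UNIV UNIV_I _ this] f
  show "d_proj (x, v) (a, b) f =
        mink a p * mink v q + mink x p * mink b q - (mink a q * mink v p + mink x q * mink b p)"
    using smooth by (simp add: d_proj_def)
qed

lemma d_proj_inj_on_chi_perp:
  assumes z: "z \<in> T1hyp" and X: "X \<in> chi_perp z" and Y: "Y \<in> chi_perp z" and eq: "d_proj z X = d_proj z Y"
  shows "X = Y"
proof -
  obtain x v a b c d where zXY: "z = (x, v)" "X = (a, b)" "Y = (c, d)"
    by (metis surj_pair)
  have xv: "(x, v) \<in> T1hyp" "mink x x = -1" "mink x v = 0" "mink v x = 0" "mink v v = 1"
    using z by (simp_all add: zXY T1hyp_iff mink_commute)
  have perp: "mink a x = 0" "mink a v = 0" "mink b x = 0" "mink b v = 0"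
    "mink c x = 0" "mink c v = 0" "mink d x = 0" "mink d v = 0"
    using X Y by (simp_all add: zXY chi_perp_iff[OF xv(1)] mink_commute)
  have tang: "(a, b) \<in> tangent_space T1hyp (x, v)" "(c, d) \<in> tangent_space T1hyp (x, v)"
    using chi_perp_tangent[OF X] chi_perp_tangent[OF Y] by (simp_all only: zXY)
  have "mink a p * mink v q + mink x p * mink b q - (mink a q * mink v p + mink x q * mink b p) =
      mink c p * mink v q + mink x p * mink d q - (mink c q * mink v p + mink x q * mink d p)" for p q
    using pluecker_test_function[of p q] xv(1) tang fun_cong[OF eq[unfolded zXY]] by metis
  \<comment> \<open>Taking \<open>p = x\<close> isolates the second components and
    \<open>p = v\<close> the first; the remaining terms vanish because all four components are
    orthogonal to \<open>x\<close> and \<open>v\<close>.\<close>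
  from this[of x] this[of v] have "mink (b - d) q = 0" "mink (a - c) q = 0" for q
    by (simp_all add: xv perp mink_simps)
  then have "b - d = 0" "a - c = 0"
    using mink_nondegenerate by blast+
  then show ?thesis
    by (simp add: zXY)
qed

text \<open>The flow carries a lift at \<open>z\<close> to a lift at \<open>z'\<close> of the same
  derivation, and lifts are unique by injectivity on \<open>chi_perp\<close>. One time
  \<open>s\<close> serves all lifts, so two vectors can be transported together.\<close>

lemma horizontal_lift_geod_flow:
  assumes "z \<in> T1hyp" "z' \<in> T1hyp" "geod_proj z' = geod_proj z"
  obtains s where "z' = geod_flow s z"
    "\<And>X X'. X \<in> chi_perp z \<Longrightarrow> X' \<in> chi_perp z' \<Longrightarrow> d_proj z' X' = d_proj z X \<Longrightarrow> X' = geod_flow s X"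
proof -
  obtain s where s: "z' = geod_flow s z"
    using geod_proj_fibre[OF assms] .
  have "X' = geod_flow s X"
    if "X \<in> chi_perp z" "X' \<in> chi_perp z'" "d_proj z' X' = d_proj z X" for X X'
    using that assms(1,2) d_proj_inj_on_chi_perp[of z' X' "geod_flow s X"]
    by (simp only: s geod_flow_chi_perp d_proj_geod_flow chi_perp_tangent)
  with s that show ?thesis
    by blast
qed

section \<open>Descent of J, the metric and the symplectic form\<close>

lemma geod_J_d_proj:
  assumes z: "z \<in> T1hyp" and X: "X \<in> chi_perp z"
  shows "geod_J (geod_proj z) (d_proj z X) = d_proj z (prod.swap X)"
  unfolding geod_J_def
proof (rule the_equality)
  show "\<exists>z' X'. z' \<in> T1hyp \<and> geod_proj z' = geod_proj z \<and> X' \<in> chi_perp z' \<and>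
      d_proj z' X' = d_proj z X \<and> d_proj z (prod.swap X) = d_proj z' (para_J z' X')"
    using z X para_J_eq[OF z X] by (intro exI[of _ z] exI[of _ X]) simp
next
  fix B
  assume "\<exists>z' X'. z' \<in> T1hyp \<and> geod_proj z' = geod_proj z \<and> X' \<in> chi_perp z' \<and>
      d_proj z' X' = d_proj z X \<and> B = d_proj z' (para_J z' X')"
  then obtain z' X' where z': "z' \<in> T1hyp" "geod_proj z' = geod_proj z"
    and X': "X' \<in> chi_perp z'" "d_proj z' X' = d_proj z X" and B: "B = d_proj z' (para_J z' X')"
    by blast
  obtain s where "z' = geod_flow s z" "X' = geod_flow s X"
    using horizontal_lift_geod_flow[OF z z'] X X' by metis
  \<comment> \<open>Since swapping commutes with the flow, the candidate at \<open>z'\<close> is the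
    flow image of the one at \<open>z\<close> and has the same projection.\<close>
  then show "B = d_proj z (prod.swap X)"
    using B para_J_eq[OF z'(1) X'(1)] d_proj_geod_flow[OF z chi_perp_tangent[OF chi_perp_swap[OF z X]]]
    by (simp add: geod_flow_swap[symmetric])
qed

lemma geod_metric_d_proj:
  assumes z: "z \<in> T1hyp" and X: "X \<in> chi_perp z" and Y: "Y \<in> chi_perp z"
  shows "geod_metric (geod_proj z) (d_proj z X) (d_proj z Y) = para_sasaki z X Y"
  unfolding geod_metric_def
proof (rule the_equality)
  show "\<exists>z' X' Y'. z' \<in> T1hyp \<and> geod_proj z' = geod_proj z \<and> X' \<in> chi_perp z' \<and> Y' \<in> chi_perp z' \<and>
      d_proj z' X' = d_proj z X \<and> d_proj z' Y' = d_proj z Y \<and> para_sasaki z X Y = para_sasaki z' X' Y'"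
    using assms by blast
next
  fix r
  assume "\<exists>z' X' Y'. z' \<in> T1hyp \<and> geod_proj z' = geod_proj z \<and> X' \<in> chi_perp z' \<and> Y' \<in> chi_perp z' \<and>
      d_proj z' X' = d_proj z X \<and> d_proj z' Y' = d_proj z Y \<and> r = para_sasaki z' X' Y'"
  then obtain z' X' Y' where z': "z' \<in> T1hyp" "geod_proj z' = geod_proj z"
    and X': "X' \<in> chi_perp z'" "d_proj z' X' = d_proj z X"
    and Y': "Y' \<in> chi_perp z'" "d_proj z' Y' = d_proj z Y" and r: "r = para_sasaki z' X' Y'"
    by blast
  obtain s where "z' = geod_flow s z" "X' = geod_flow s X" "Y' = geod_flow s Y"
    using horizontal_lift_geod_flow[OF z z'] X X' Y Y' by metis
  then show "r = para_sasaki z X Y"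
    using r para_sasaki_geod_flow[OF assms] by simp
qed

lemma proj_pullback_geod_symp:
  assumes z: "z \<in> T1hyp" and X: "X \<in> tangent_space T1hyp z" and Y: "Y \<in> tangent_space T1hyp z"
  shows "proj_pullback geod_symp z X Y = mink (fst X) (snd Y) - mink (snd X) (fst Y)"
proof -
  obtain x v a b c d where eq: "z = (x, v)" "X = (a, b)" "Y = (c, d)"
    by (metis surj_pair)
  let ?X = "X - conn_form z X *\<^sub>R flow_gen z" and ?Y = "Y - conn_form z Y *\<^sub>R flow_gen z"
  have zxv: "(x, v) \<in> T1hyp"
    using z by (simp only: eq)
  have tang: "mink a x = 0" "mink v d = 0" "mink b v = 0" "mink x c = 0" "mink v x = 0" "mink x v = 0"
    using X Y z unfolding eq tangent_space_T1hyp[OF zxv] by (simp_all add: T1hyp_iff mink_commute)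
  have hor: "?X \<in> chi_perp z" "?Y \<in> chi_perp z"
    using horizontal_part[OF z X] horizontal_part[OF z Y] .
  have "proj_pullback geod_symp z X Y = geod_symp (geod_proj z) (d_proj z ?X) (d_proj z ?Y)"
    using d_proj_horizontal_part[OF z X] d_proj_horizontal_part[OF z Y] by (simp add: proj_pullback_def)
  also have "\<dots> = para_sasaki z ?X (prod.swap ?Y)"
    unfolding geod_symp_def geod_J_d_proj[OF z hor(2)]
    by (intro geod_metric_d_proj z hor chi_perp_swap)
  also have "\<dots> = mink (fst ?X) (snd ?Y) - mink (snd ?X) (fst ?Y)"
    using para_sasaki_chi_perp[OF z hor(1) chi_perp_swap[OF z hor(2)]] by simp
  \<comment> \<open>Every correction by a multiple of \<open>flow_gen z\<close> pairs to zero by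
    tangency, so the formula holds for \<open>X\<close> and \<open>Y\<close> themselves.\<close>
  also have "\<dots> = mink (fst X) (snd Y) - mink (snd X) (fst Y)"
    unfolding eq flow_gen_def by (simp add: mink_simps tang)
  finally show ?thesis .
qed

section \<open>The exterior derivative of the connection form\<close>

lemma tangent_space_T1hyp_iff:
  assumes "q \<in> T1hyp"
  shows "W \<in> tangent_space T1hyp q \<longleftrightarrow>
    mink (fst q) (fst W) = 0 \<and> mink (snd q) (snd W) = 0 \<and>
    mink (fst W) (snd q) + mink (fst q) (snd W) = 0"
proof -
  obtain x v a b where "q = (x, v)" "W = (a, b)"
    by (metis surj_pair)
  then show ?thesis
    using assms tangent_space_T1hyp[of x v] by simp
qed

text \<open>Without fields through the given vectors, the definite description in
  \<open>ext_deriv\<close> would range over a vacuous condition and have no unique value.\<close>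

lemma vector_field_extending:
  assumes z: "z \<in> T1hyp" and X: "X \<in> tangent_space T1hyp z"
  obtains \<xi> where "vector_field T1hyp \<xi>" "\<xi> z = X"
proof -
  obtain x v where xv: "z = (x, v)"
    by (metis surj_pair)
  define k where "k = conn_form z X"
  obtain a b where ab: "X - k *\<^sub>R flow_gen z = (a, b)"
    by (metis surj_pair)
  \<comment> \<open>Keep the coefficient of the flow direction constant and project the rest to the complement
    of the span of the base point and its velocity.\<close>
  define \<xi> where "\<xi> q = k *\<^sub>R (snd q, fst q) +
    (a + mink (fst q) a *\<^sub>R fst q - mink (snd q) a *\<^sub>R snd q,
     b + mink (fst q) b *\<^sub>R fst q - mink (snd q) b *\<^sub>R snd q)" for q
  have "mink x a = 0" "mink v a = 0" "mink x b = 0" "mink v b = 0"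
    using horizontal_part[OF assms, folded k_def, unfolded ab] z chi_perp_iff[of x v a b]
    by (simp_all add: xv)
  then have "\<xi> z = k *\<^sub>R flow_gen z + (a, b)"
    by (simp add: \<xi>_def xv flow_gen_def)
  then have "\<xi> z = X"
    by (simp flip: ab)
  moreover have "\<xi> q \<in> tangent_space T1hyp q" if "q \<in> T1hyp" for q
  proof -
    obtain y u where q: "q = (y, u)"
      by (metis surj_pair)
    have "mink y y = -1" "mink y u = 0" "mink u y = 0" "mink u u = 1"
      using that by (simp_all add: q T1hyp_iff mink_commute)
    then show ?thesis
      unfolding tangent_space_T1hyp_iff[OF that] unfolding \<xi>_def q
      by (simp add: mink_simps mink_commute[of a u] mink_commute[of b u])
  qed
  moreover have "smooth_map T1hyp \<xi>"
    unfolding \<xi>_def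
    by (intro smooth_map_of_Ck_on_UNIV Ck_on_diff Ck_on_add Ck_on_Pair
        Ck_on_bilinear[OF bounded_bilinear_scaleR] Ck_on_const Ck_on_bounded_linear[OF bounded_linear_mink_fst]
        Ck_on_bounded_linear[OF bounded_linear_mink_snd] open_UNIV
        Ck_on_bounded_linear[OF bounded_linear_fst] Ck_on_bounded_linear[OF bounded_linear_snd])
  ultimately show ?thesis
    using that unfolding vector_field_def by blast
qed

text \<open>The ambient derivative of a field need not be tangent: differentiating the tangency
  equations leaves an inhomogeneous part. This part is symmetric in \<open>W\<close> and
  \<open>\<xi> z\<close>, so it cancels in the bracket.\<close>

lemma vector_field_derivative_constraints:
  assumes \<xi>: "vector_field T1hyp \<xi>" and z: "z \<in> T1hyp" and W: "W \<in> tangent_space T1hyp z"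
    and U: "open U" "z \<in> U" "\<And>q. q \<in> U \<inter> T1hyp \<Longrightarrow> \<xi> q = F q" and D: "(F has_derivative D) (at z)"
  shows "mink (fst z) (fst (D W)) + mink (fst W) (fst (\<xi> z)) = 0"
    and "mink (snd z) (snd (D W)) + mink (snd W) (snd (\<xi> z)) = 0"
    and "mink (fst (\<xi> z)) (snd W) + mink (fst (D W)) (snd z)
      + (mink (fst z) (snd (D W)) + mink (fst W) (snd (\<xi> z))) = 0"
proof -
  have Fz: "F z = \<xi> z"
    using U z by simp
  have tang: "mink (fst q) (fst (F q)) = 0" "mink (snd q) (snd (F q)) = 0"
    "mink (fst (F q)) (snd q) + mink (fst q) (snd (F q)) = 0" if "q \<in> U \<inter> T1hyp" for q
    using \<xi> U(3)[OF that] that tangent_space_T1hyp_iff[of q "\<xi> q"] unfolding vector_field_def by auto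
  note der = has_derivative_fst[OF has_derivative_ident] has_derivative_snd[OF has_derivative_ident]
    has_derivative_fst[OF D] has_derivative_snd[OF D]
  show "mink (fst z) (fst (D W)) + mink (fst W) (fst (\<xi> z)) = 0"
    using derivative_level_set[OF W U(1,2) tang(1) mink.FDERIV[OF der(1,3)]] by (simp add: Fz)
  show "mink (snd z) (snd (D W)) + mink (snd W) (snd (\<xi> z)) = 0"
    using derivative_level_set[OF W U(1,2) tang(2) mink.FDERIV[OF der(2,4)]] by (simp add: Fz)
  show "mink (fst (\<xi> z)) (snd W) + mink (fst (D W)) (snd z)
      + (mink (fst z) (snd (D W)) + mink (fst W) (snd (\<xi> z))) = 0"
    using derivative_level_set[OF W U(1,2) tang(3)
        has_derivative_add[OF mink.FDERIV[OF der(3,2)] mink.FDERIV[OF der(1,4)]]]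
    by (simp add: Fz)
qed

lemma conn_form_fst:
  "z \<in> T1hyp \<Longrightarrow> X \<in> tangent_space T1hyp z \<Longrightarrow> conn_form z X = mink (fst X) (snd z)"
  using conn_form_eq[of "fst z" "snd z" "fst X" "snd X"] by simp

lemma deriv_along_conn_form:
  assumes \<xi>: "vector_field T1hyp \<xi>" and z: "z \<in> T1hyp" and W: "W \<in> tangent_space T1hyp z"
    and U: "open U" "z \<in> U" "\<And>q. q \<in> U \<inter> T1hyp \<Longrightarrow> \<xi> q = F q" and D: "(F has_derivative D) (at z)"
  shows "deriv_along T1hyp (\<lambda>q. conn_form q (\<xi> q)) z W = mink (fst (\<xi> z)) (snd W) + mink (fst (D W)) (snd z)"
proof -
  have eq: "conn_form q (\<xi> q) = mink (fst (F q)) (snd q)" if "q \<in> U \<inter> T1hyp" for q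
    using that conn_form_fst[of q "\<xi> q"] \<xi> U(3)[OF that] unfolding vector_field_def by (metis IntE)
  have der: "((\<lambda>q. mink (fst (F q)) (snd q)) has_derivative
      (\<lambda>h. mink (fst (F z)) (snd h) + mink (fst (D h)) (snd z))) (at z)"
    by (intro mink.FDERIV has_derivative_fst has_derivative_snd D has_derivative_ident)
  show ?thesis
    using deriv_along_extension[OF W U(1,2) eq der] U(2,3) z by simp
qed

text \<open>By the product rule each derivative of the form has a term differentiating the field and
  a term differentiating the velocity \<open>snd z\<close>. The former cancel against the form
  applied to the bracket, and the latter give the result.\<close>

lemma ext_deriv_conn_form:
  assumes z: "z \<in> T1hyp" and X: "X \<in> tangent_space T1hyp z" and Y: "Y \<in> tangent_space T1hyp z"
  shows "ext_deriv T1hyp conn_form z X Y = mink (snd X) (fst Y) - mink (fst X) (snd Y)"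
  unfolding ext_deriv_def
proof (rule the_equality)
  let ?d = "\<lambda>\<xi> \<eta>. deriv_along T1hyp (\<lambda>q. conn_form q (\<eta> q)) z X -
    deriv_along T1hyp (\<lambda>q. conn_form q (\<xi> q)) z Y - conn_form z (lie_bracket T1hyp \<xi> \<eta> z)"
  have eq: "mink (snd X) (fst Y) - mink (fst X) (snd Y) = ?d \<xi> \<eta>"
    if fields: "vector_field T1hyp \<xi>" "vector_field T1hyp \<eta>" and at_z: "\<xi> z = X" "\<eta> z = Y" for \<xi> \<eta>
  proof -
    obtain U F DF where F: "open U" "z \<in> U" "\<And>q. q \<in> U \<inter> T1hyp \<Longrightarrow> \<xi> q = F q"
      "(F has_derivative DF) (at z)"
      using smooth_map_extension[of T1hyp \<xi> z] fields z unfolding vector_field_def by metis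
    obtain V G DG where G: "open V" "z \<in> V" "\<And>q. q \<in> V \<inter> T1hyp \<Longrightarrow> \<eta> q = G q"
      "(G has_derivative DG) (at z)"
      using smooth_map_extension[of T1hyp \<eta> z] fields z unfolding vector_field_def by metis
    let ?B = "DG X - DF Y"
    have bracket: "lie_bracket T1hyp \<xi> \<eta> z = ?B"
      using deriv_along_extension[OF Y F] deriv_along_extension[OF X G]
      by (simp add: lie_bracket_def at_z)
    \<comment> \<open>The coordinate formula for \<open>conn_form\<close> is available only on
      tangent vectors, so tangency of the bracket has to be established first.\<close>
    have "?B \<in> tangent_space T1hyp z"
      using vector_field_derivative_constraints[OF fields(1) z Y F]
        vector_field_derivative_constraints[OF fields(2) z X G]
        mink_commute[of "fst X" "fst Y"] mink_commute[of "snd X" "snd Y"]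
      unfolding tangent_space_T1hyp_iff[OF z] at_z by (simp add: mink_simps)
    then have "conn_form z (lie_bracket T1hyp \<xi> \<eta> z) = mink (fst ?B) (snd z)"
      unfolding bracket using z by (simp add: conn_form_fst)
    then show ?thesis
      using deriv_along_conn_form[OF fields(1) z Y F] deriv_along_conn_form[OF fields(2) z X G]
        mink_commute[of "snd X" "fst Y"]
      by (simp add: at_z mink_simps)
  qed
  then show "\<forall>\<xi> \<eta>. vector_field T1hyp \<xi> \<and> vector_field T1hyp \<eta> \<and> \<xi> z = X \<and> \<eta> z = Y \<longrightarrow>
      mink (snd X) (fst Y) - mink (fst X) (snd Y) = ?d \<xi> \<eta>"
    by blast
  fix r
  assume r: "\<forall>\<xi> \<eta>. vector_field T1hyp \<xi> \<and> vector_field T1hyp \<eta> \<and> \<xi> z = X \<and> \<eta> z = Y \<longrightarrow> r = ?d \<xi> \<eta>"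
  obtain \<xi> where \<xi>: "vector_field T1hyp \<xi>" "\<xi> z = X"
    using vector_field_extending[OF z X] .
  obtain \<eta> where \<eta>: "vector_field T1hyp \<eta>" "\<eta> z = Y"
    using vector_field_extending[OF z Y] .
  have "r = ?d \<xi> \<eta>"
    using r \<xi> \<eta> by blast
  also have "\<dots> = mink (snd X) (fst Y) - mink (fst X) (snd Y)"
    using eq[OF \<xi>(1) \<eta>(1) \<xi>(2) \<eta>(2)] by (rule sym)
  finally show "r = mink (snd X) (fst Y) - mink (fst X) (snd Y)" .
qed

text \<open>Both sides are now explicit and opposite to each other. The sign belongs to the chosen
  conventions: for \<open>X = hor w\<close> and \<open>Y = vert w\<close> with \<open>w\<close> in
  \<open>perp z\<close>, the exterior derivative is \<open>- mink w w\<close> and the pullback is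
  \<open>mink w w\<close>.\<close>

theorem proposition5p4:
  fixes z X Y :: "'m::finite mink \<times> 'm mink"
  assumes "z \<in> T1hyp"
    and "X \<in> tangent_space T1hyp z" and "Y \<in> tangent_space T1hyp z"
  shows "ext_deriv T1hyp conn_form z X Y = - proj_pullback geod_symp z X Y"
  using ext_deriv_conn_form[OF assms] proj_pullback_geod_symp[OF assms] by simp

end
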